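(* Let $d\ge2$, let $\Gamma$ be a uniform lattice in $\mathrm{SO}^+(d,1)$ and let $\tau:\Gamma\to\mathbb R^{d+1}$ be a cocycle. The covolume is a convex function on the set of $\tau$-convex sets: for all $\tau$-convex sets $K_0,K_1$ and all $\lambda\in[0,1]$, $$\mathrm{covol}\big((1-\lambda)K_0+\lambda K_1\big)\le(1-\lambda)\,\mathrm{covol}(K_0)+\lambda\,\mathrm{covol}(K_1).$$
   Context: Minkowski space $\mathbb R^{d,1}$ is $\mathbb R^{d+1}$ with $\langle X,Y\rangle_-=\sum_{i=1}^dX_iY_i-X_{d+1}Y_{d+1}$; $I^+(0)=\{X:\langle X,X\rangle_-<0,\ X_{d+1}>0\}$; $\mathbb H^d=\{X:\langle X,X\rangle_-=-1,\ X_{d+1}>0\}$. $\mathrm{SO}^+(d,1)$ is the group of orientation preserving linear isometries of $\mathbb R^{d,1}$ preserving $I^+(0)$. A uniform lattice is a discrete subgroup $\Gamma$ with $\mathbb H^d/\Gamma$ compact. A cocycle is a map $\tau:\Gamma\to\mathbb R^{d+1}$ with $\tau_{\alpha\beta}=\tau_\alpha+\alpha\tau_\beta$; it defines the group $\Gamma_\tau=\{X\mapsto\gamma X+\tau_\gamma \mid \gamma\in\Gamma\}$ of isometries of $\mathbb R^{d,1}$. A $\tau$-convex set is a non-empty closed convex set $K\subsetneq\mathbb R^{d+1}$, globally invariant under $\Gamma_\tau$, which is future, i.e. disjoint from the past of its support planes (equivalently $K+I^+(0)\subset K$). Each $\tau$-convex set is determined by its support function $H(X)=\sup_{p\in K}\langle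 p,X\rangle_-$, finite on $I^+(0)$. The combination $(1-\lambda)K_0+\lambda K_1$ is formed with homotheties and Minkowski addition; it is the $\tau$-convex set with support function $(1-\lambda)H_0+\lambda H_1$. It is known that there is a maximal $\tau$-convex set $\Omega_\tau$, containing all $\tau$-convex sets, and that $\Gamma_\tau$ acts properly discontinuously on the interior of $\Omega_\tau$. The covolume $\mathrm{covol}(K)$ of a $\tau$-convex set $K$ is the volume of $(\Omega_\tau\setminus K)/\Gamma_\tau$, i.e. the Lebesgue measure of the intersection of $\Omega_\tau\setminus K$ with a fundamental domain for the action of $\Gamma_\tau$; it is finite. *)

theory Defs
  imports "HOL-Analysis.Analysis"
begin

text \<open>Minkowski space of dimension \<open>d + 1\<close>, where \<open>d = CARD('d)\<close>: the coordinate \<open>None\<close> is the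
  time coordinate, written \<open>X\<^sub>d\<^sub>+\<^sub>1\<close> in the usual notation.\<close>

type_synonym 'd mink = "real ^ 'd option"
type_synonym 'd mink_mat = "real ^ 'd option ^ 'd option"

definition mink :: "'d::finite mink \<Rightarrow> 'd mink \<Rightarrow> real" where
  "mink X Y = (\<Sum>i\<in>UNIV. X $ Some i * Y $ Some i) - X $ None * Y $ None"

definition chron_future :: "'d::finite mink set" where
  "chron_future = {X. mink X X < 0 \<and> X $ None > 0}"

definition hyp :: "'d::finite mink set" where
  "hyp = {X. mink X X = -1 \<and> X $ None > 0}"

definition SO_plus :: "'d::finite mink_mat set" where
  "SO_plus = {A. (\<forall>X Y. mink (A *v X) (A *v Y) = mink X Y) \<and> det A > 0
                 \<and> (\<lambda>X. A *v X) ` chron_future = chron_future}"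

definition orbit :: "'d::finite mink_mat set \<Rightarrow> 'd mink \<Rightarrow> 'd mink set" where
  "orbit \<Gamma> X = (\<lambda>\<gamma>. \<gamma> *v X) ` \<Gamma>"

text \<open>The quotient topology on the set of \<open>\<Gamma>\<close>-orbits in hyperbolic space.\<close>

definition hyp_quotient :: "'d::finite mink_mat set \<Rightarrow> 'd mink set topology" where
  "hyp_quotient \<Gamma> = topology (\<lambda>U. U \<subseteq> orbit \<Gamma> ` hyp
      \<and> openin (top_of_set hyp) {X \<in> hyp. orbit \<Gamma> X \<in> U})"

lemma openin_hyp_quotient:
  "openin (hyp_quotient \<Gamma>) U \<longleftrightarrow>
     U \<subseteq> orbit \<Gamma> ` hyp \<and> openin (top_of_set hyp) {X \<in> hyp. orbit \<Gamma> X \<in> U}"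
proof -
  have "istopology (\<lambda>U. U \<subseteq> orbit \<Gamma> ` hyp
      \<and> openin (top_of_set hyp) {X \<in> hyp. orbit \<Gamma> X \<in> U})" (is "istopology ?P")
    unfolding istopology_def
  proof (rule conjI; intro allI impI)
    fix S T assume S: "?P S" and T: "?P T"
    have "{X \<in> hyp. orbit \<Gamma> X \<in> S \<inter> T} = {X \<in> hyp. orbit \<Gamma> X \<in> S} \<inter> {X \<in> hyp. orbit \<Gamma> X \<in> T}"
      by (rule set_eqI) blast
    then have "openin (top_of_set hyp) {X \<in> hyp. orbit \<Gamma> X \<in> S \<inter> T}"
      by (simp only: openin_Int[OF conjunct2[OF S] conjunct2[OF T]])
    with S show "?P (S \<inter> T)"
      by (iprover intro: subset_trans[OF Int_lower1])
  next
    fix \<K> assume *: "\<forall>K\<in>\<K>. ?P K"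
    have "{X \<in> hyp. orbit \<Gamma> X \<in> \<Union>\<K>} = \<Union>((\<lambda>K. {X \<in> hyp. orbit \<Gamma> X \<in> K}) ` \<K>)"
      by (rule set_eqI) blast
    moreover have "openin (top_of_set hyp) (\<Union>((\<lambda>K. {X \<in> hyp. orbit \<Gamma> X \<in> K}) ` \<K>))"
    proof (rule openin_Union)
      fix V assume "V \<in> (\<lambda>K. {X \<in> hyp. orbit \<Gamma> X \<in> K}) ` \<K>"
      then obtain K where K: "K \<in> \<K>" and V: "V = {X \<in> hyp. orbit \<Gamma> X \<in> K}"
        by (rule imageE)
      show "openin (top_of_set hyp) V"
        unfolding V by (rule conjunct2[OF bspec[OF * K]])
    qed
    moreover have "\<Union>\<K> \<subseteq> orbit \<Gamma> ` hyp"
      by (rule Union_least) (rule conjunct1[OF bspec[OF *]])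
    ultimately show "?P (\<Union>\<K>)"
      by (simp only:)
  qed
  then show ?thesis
    unfolding hyp_quotient_def by (rule fun_cong[OF topology_inverse'])
qed

definition uniform_lattice :: "'d::finite mink_mat set \<Rightarrow> bool" where
  "uniform_lattice \<Gamma> \<longleftrightarrow>
     \<Gamma> \<subseteq> SO_plus \<and> mat 1 \<in> \<Gamma> \<and> (\<forall>\<alpha>\<in>\<Gamma>. \<forall>\<beta>\<in>\<Gamma>. \<alpha> ** \<beta> \<in> \<Gamma>) \<and> (\<forall>\<alpha>\<in>\<Gamma>. matrix_inv \<alpha> \<in> \<Gamma>)
     \<and> discrete \<Gamma> \<and> compact_space (hyp_quotient \<Gamma>)"

definition cocycle :: "'d::finite mink_mat set \<Rightarrow> ('d mink_mat \<Rightarrow> 'd mink) \<Rightarrow> bool" where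
  "cocycle \<Gamma> \<tau> \<longleftrightarrow> (\<forall>\<alpha>\<in>\<Gamma>. \<forall>\<beta>\<in>\<Gamma>. \<tau> (\<alpha> ** \<beta>) = \<tau> \<alpha> + \<alpha> *v \<tau> \<beta>)"

text \<open>The isometry of \<open>\<Gamma>\<^sub>\<tau>\<close> associated with \<open>\<gamma> \<in> \<Gamma>\<close>.\<close>

definition aff :: "('d::finite mink_mat \<Rightarrow> 'd mink) \<Rightarrow> 'd mink_mat \<Rightarrow> 'd mink \<Rightarrow> 'd mink" where
  "aff \<tau> \<gamma> X = \<gamma> *v X + \<tau> \<gamma>"

text \<open>In \<open>K + chron_future\<close>, and everywhere below, \<open>+\<close> on sets is Minkowski addition.\<close>

definition tau_convex ::
    "'d::finite mink_mat set \<Rightarrow> ('d mink_mat \<Rightarrow> 'd mink) \<Rightarrow> 'd mink set \<Rightarrow> bool" where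
  "tau_convex \<Gamma> \<tau> K \<longleftrightarrow>
     K \<noteq> {} \<and> K \<noteq> UNIV \<and> closed K \<and> convex K
     \<and> (\<forall>\<gamma>\<in>\<Gamma>. aff \<tau> \<gamma> ` K = K) \<and> K + chron_future \<subseteq> K"

text \<open>\<open>GREATEST\<close> is with respect to inclusion: the \<open>\<tau>\<close>-convex set containing all the others.\<close>

definition max_tau_convex ::
    "'d::finite mink_mat set \<Rightarrow> ('d mink_mat \<Rightarrow> 'd mink) \<Rightarrow> 'd mink set" where
  "max_tau_convex \<Gamma> \<tau> = (GREATEST K. tau_convex \<Gamma> \<tau> K)"

text \<open>Fundamental domains for the action of \<open>\<Gamma>\<^sub>\<tau>\<close> on the interior of the maximal set, in the
  measure-theoretic sense: the translates cover up to a null set and overlap in null sets. Both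
  strict sets of orbit representatives and closed (e.g. Dirichlet) domains with null boundary
  qualify. The frontier of the maximal set is a null set and so does not matter for volumes.\<close>

definition fundamental_domain ::
    "'d::finite mink_mat set \<Rightarrow> ('d mink_mat \<Rightarrow> 'd mink) \<Rightarrow> 'd mink set \<Rightarrow> bool" where
  "fundamental_domain \<Gamma> \<tau> F \<longleftrightarrow>
     F \<in> sets lebesgue \<and> F \<subseteq> interior (max_tau_convex \<Gamma> \<tau>)
     \<and> (AE X in lebesgue. X \<in> interior (max_tau_convex \<Gamma> \<tau>) \<longrightarrow> (\<exists>\<gamma>\<in>\<Gamma>. X \<in> aff \<tau> \<gamma> ` F))
     \<and> (\<forall>\<gamma>\<in>\<Gamma>. \<gamma> \<noteq> mat 1 \<longrightarrow> aff \<tau> \<gamma> ` F \<inter> F \<in> null_sets lebesgue)"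

text \<open>Since \<open>\<Gamma>\<close> is countable and acts by volume preserving maps, the value does not depend on
  the chosen fundamental domain.\<close>

definition covol ::
    "'d::finite mink_mat set \<Rightarrow> ('d mink_mat \<Rightarrow> 'd mink) \<Rightarrow> 'd mink set \<Rightarrow> ennreal" where
  "covol \<Gamma> \<tau> K =
     emeasure lebesgue ((max_tau_convex \<Gamma> \<tau> - K) \<inter> (SOME F. fundamental_domain \<Gamma> \<tau> F))"

end

theory Submission
  imports Defs
begin

text \<open>The covolume is computed in a fundamental domain for which convexity is visible on every line of
  a fixed timelike direction.

  Fix a future timelike vector \<open>v\<close> with trivial stabilizer in \<open>\<Gamma>\<close>. Let \<open>P\<close> consist of the interior points
  of the maximal set \<open>\<Omega>\<close> at which the linear functional \<open>\<langle>\<cdot>, v\<rangle>\<close> takes its largest value on the orbit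
  under \<open>\<Gamma>\<^sub>\<tau>\<close>. Since \<open>\<langle>\<cdot>, v\<rangle>\<close> is bounded above on \<open>\<Omega>\<close> and \<open>\<Gamma>\<close> is discrete, the largest value is attained on
  every orbit of interior points, and distinct translates of \<open>P\<close> meet only in hyperplanes. So \<open>P\<close> is a
  fundamental domain (\<open>fundamental_domain_dirichlet\<close>), and volumes of invariant sets may be computed in
  it (\<open>fundamental_domain_le\<close>). By the reversed Cauchy-Schwarz inequality \<open>\<langle>g v, v\<rangle> \<le> \<langle>v, v\<rangle>\<close>, the set \<open>P\<close>
  satisfies \<open>P + s v \<subseteq> P\<close> for \<open>s \<ge> 0\<close> (\<open>dirichlet_future\<close>), and every \<open>\<tau>\<close>-convex set has the same property. Hence a
  line in direction \<open>v\<close> meets \<open>P\<close> and \<open>K\<^sub>0\<close>, \<open>K\<^sub>1\<close> in half lines, with starting parameters \<open>e\<close> and \<open>k\<^sub>0\<close>, \<open>k\<^sub>1\<close>. It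
  meets \<open>(1 - t) K\<^sub>0 + t K\<^sub>1\<close> in a half line starting not later than \<open>(1 - t) k\<^sub>0 + t k\<^sub>1\<close>, and since
  \<open>max 0 (k - e)\<close> is convex in \<open>k\<close>, the length of the part of the line in \<open>P\<close> but below the convex set is convex.
  Integration over the lines (\<open>emeasure_lborel_slices\<close>) gives the theorem.

  What remains is that \<open>\<Omega>\<close> exists and that \<open>\<langle>\<cdot>, v\<rangle>\<close> is bounded above on it. By cocompactness, points of an orbit
  \<open>\<Gamma> v\<close> approach every null direction (\<open>orbit_direction\<close>), so that the convex cone spanned by \<open>\<Gamma> v\<close> is the whole
  future cone (\<open>chron_future_subset_cone\<close>). In particular \<open>v\<close> is a combination of orbit points with
  coefficients of sum less than 1, and equivariance of the support functions yields an upper bound for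
  \<open>\<langle>\<cdot>, v\<rangle>\<close> common to all \<open>\<tau>\<close>-convex sets (\<open>tau_convex_uniformly_bounded_above\<close>). This presupposes that a
  single \<open>\<tau>\<close>-convex set has some timelike supporting direction. It has a causal one, and if that is null it
  can be added to a translate of itself, because \<open>\<Gamma>\<close> preserves no null direction
  (\<open>null_direction_moved\<close>); this last point rests on the discreteness of \<open>\<Gamma>\<close> and on \<open>d \<ge> 2\<close>.\<close>

section \<open>The Minkowski product and the future cone\<close>

definition space_part :: "'d::finite mink \<Rightarrow> real ^ 'd" where
  "space_part X = (\<chi> i. X $ Some i)"

definition event :: "real ^ 'd \<Rightarrow> real \<Rightarrow> 'd::finite mink" where
  "event x s = (\<chi> i. case i of None \<Rightarrow> s | Some j \<Rightarrow> x $ j)"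

definition time_reflect :: "'d::finite mink \<Rightarrow> 'd mink" where
  "time_reflect X = event (space_part X) (- (X $ None))"

lemma space_part_event [simp]: "space_part (event x s) = x"
  by (simp add: space_part_def event_def vec_eq_iff)

lemma event_None [simp]: "event x s $ None = s"
  by (simp add: event_def)

lemma space_part_linear [simp]:
  "space_part (X + Y) = space_part X + space_part Y"
  "space_part (X - Y) = space_part X - space_part Y"
  "space_part (- X) = - space_part X"
  "space_part (c *\<^sub>R X) = c *\<^sub>R space_part X"
  "space_part 0 = 0"
  by (simp_all add: space_part_def vec_eq_iff)

lemma mink_eqI: "space_part X = space_part Y \<Longrightarrow> X $ None = Y $ None \<Longrightarrow> X = Y"
  by (simp add: space_part_def vec_eq_iff) (metis not_None_eq)

lemma mink_space_part: "mink X Y = space_part X \<bullet> space_part Y - X $ None * Y $ None"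
  by (simp add: mink_def space_part_def inner_vec_def)

lemma inner_space_part: "X \<bullet> Y = space_part X \<bullet> space_part Y + X $ None * Y $ None"
  by (simp add: space_part_def inner_vec_def UNIV_option_conv sum.reindex)

lemma mink_inner: "mink X Y = X \<bullet> time_reflect Y"
  by (simp add: mink_space_part inner_space_part time_reflect_def)

lemma mink_sym: "mink X Y = mink Y X"
  by (simp add: mink_space_part inner_commute)

lemma mink_bilinear:
  "mink (X + Y) Z = mink X Z + mink Y Z" "mink Z (X + Y) = mink Z X + mink Z Y"
  "mink (X - Y) Z = mink X Z - mink Y Z" "mink Z (X - Y) = mink Z X - mink Z Y"
  "mink (c *\<^sub>R X) Z = c * mink X Z" "mink Z (c *\<^sub>R X) = c * mink Z X"
  "mink (- X) Z = - mink X Z" "mink Z (- X) = - mink Z X"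
  "mink 0 Z = 0" "mink Z 0 = 0"
  by (simp_all add: mink_space_part inner_simps algebra_simps)

lemma time_reflect_involution [simp]: "time_reflect (time_reflect X) = X"
  by (rule mink_eqI) (simp_all add: time_reflect_def)

lemma norm_time_reflect [simp]: "norm (time_reflect X) = norm X"
  by (simp add: norm_eq_sqrt_inner inner_space_part time_reflect_def)

lemma time_reflect_eq_0 [simp]: "time_reflect X = 0 \<longleftrightarrow> X = 0"
  by (metis norm_eq_zero norm_time_reflect)

lemma mink_time_reflect: "mink X (time_reflect Y) = X \<bullet> Y"
  by (simp add: mink_inner)

lemma abs_mink_le: "\<bar>mink X Y\<bar> \<le> norm X * norm Y"
  unfolding mink_inner using Cauchy_Schwarz_ineq2[of X "time_reflect Y"] by simp

lemma continuous_on_mink [continuous_intros]: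
  "continuous_on S f \<Longrightarrow> continuous_on S (\<lambda>x. mink (f x) Y)"
  unfolding mink_inner by (intro continuous_intros)

lemma norm_space_time: "(norm X)\<^sup>2 = (norm (space_part X))\<^sup>2 + (X $ None)\<^sup>2"
  using inner_space_part[of X X] by (simp add: dot_square_norm power2_eq_square[of "X $ None"])

lemma mink_self: "mink X X = (norm (space_part X))\<^sup>2 - (X $ None)\<^sup>2"
  using mink_space_part[of X X] by (simp add: dot_square_norm power2_eq_square[of "X $ None"])

lemma norm_space_part_le: "norm (space_part X) \<le> norm X"
  by (rule power2_le_imp_le) (simp_all add: norm_space_time)

lemma chron_future_iff: "X \<in> chron_future \<longleftrightarrow> norm (space_part X) < X $ None"
proof
  assume "X \<in> chron_future"
  then have "(norm (space_part X))\<^sup>2 < (X $ None)\<^sup>2" "X $ None > 0"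
    by (auto simp: chron_future_def mink_self)
  then show "norm (space_part X) < X $ None"
    by (meson less_eq_real_def power2_less_imp_less)
next
  assume *: "norm (space_part X) < X $ None"
  then have "0 < X $ None" by (meson norm_ge_zero order_le_less_trans)
  then show "X \<in> chron_future"
    using * by (auto simp: chron_future_def mink_self intro: power_strict_mono)
qed

lemma chron_future_time_pos: "X \<in> chron_future \<Longrightarrow> X $ None > 0"
  by (simp add: chron_future_def)

lemma chron_future_mink_neg: "X \<in> chron_future \<Longrightarrow> mink X X < 0"
  by (simp add: chron_future_def)

lemma open_chron_future: "open (chron_future :: 'd::finite mink set)"
proof -
  have "chron_future = {X :: 'd mink. norm (space_part X) < X $ None}"
    using chron_future_iff by blast
  moreover have "continuous_on UNIV (\<lambda>X :: 'd mink. norm (space_part X))"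
    unfolding space_part_def by (intro continuous_intros)
  ultimately show ?thesis
    using open_Collect_less[of "\<lambda>X :: 'd mink. norm (space_part X)" "\<lambda>X. X $ None"]
    by (simp add: continuous_on_component)
qed

lemma chron_future_scale: "X \<in> chron_future \<Longrightarrow> c > 0 \<Longrightarrow> c *\<^sub>R X \<in> chron_future"
  by (simp add: chron_future_iff)

lemma event_0_1_chron_future: "event 0 1 \<in> chron_future"
  by (simp add: chron_future_iff)

lemma mink_chron_future_causal_neg:
  assumes "X \<in> chron_future" "norm (space_part Y) \<le> Y $ None" "Y \<noteq> 0"
  shows "mink X Y < 0"
proof -
  have Y: "Y $ None > 0"
  proof (rule ccontr)
    assume "\<not> ?thesis"
    with assms(2) have "norm (space_part Y) \<le> 0" "Y $ None = 0" 
      using norm_ge_zero[of "space_part Y"] by linarith+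
    then show False using assms(3) mink_eqI[of Y 0] by simp
  qed
  have "space_part X \<bullet> space_part Y \<le> norm (space_part X) * norm (space_part Y)"
    by (rule norm_cauchy_schwarz)
  also have "\<dots> \<le> norm (space_part X) * Y $ None"
    using assms by (intro mult_left_mono) auto
  also have "\<dots> < X $ None * Y $ None"
    using assms Y by (simp add: chron_future_iff)
  finally show ?thesis by (simp add: mink_space_part)
qed

lemma mink_chron_future_neg:
  "X \<in> chron_future \<Longrightarrow> Y \<in> chron_future \<Longrightarrow> mink X Y < 0"
  by (metis chron_future_iff chron_future_time_pos less_imp_le less_irrefl
      mink_chron_future_causal_neg zero_index)

text \<open>The functional \<open>- \<langle>\<cdot>, X\<rangle>\<close> with \<open>X\<close> future timelike is proper on the causal future.\<close>
lemma norm_le_mink_chron_future: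
  assumes X: "X \<in> chron_future" and Y: "norm (space_part Y) \<le> Y $ None"
  shows "norm Y * (X $ None - norm (space_part X)) \<le> 2 * - mink Y X"
proof -
  have Y0: "Y $ None \<ge> 0" using Y norm_ge_zero order_trans by blast
  have "norm Y \<le> 2 * Y $ None"
  proof (rule power2_le_imp_le)
    have "(norm (space_part Y))\<^sup>2 \<le> (Y $ None)\<^sup>2" using Y by (intro power_mono) auto
    then show "(norm Y)\<^sup>2 \<le> (2 * Y $ None)\<^sup>2"
      by (simp add: norm_space_time power_mult_distrib)
        (use zero_le_power2[of "Y $ None"] in linarith)
  qed (use Y0 in simp)
  then have "norm Y * (X $ None - norm (space_part X))
      \<le> 2 * Y $ None * (X $ None - norm (space_part X))"
    using X by (intro mult_right_mono) (auto simp: chron_future_iff)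
  moreover have "space_part Y \<bullet> space_part X \<le> Y $ None * norm (space_part X)"
    using norm_cauchy_schwarz[of "space_part Y" "space_part X"] Y
      mult_right_mono[of "norm (space_part Y)" "Y $ None" "norm (space_part X)"] by simp
  ultimately show ?thesis by (simp add: mink_space_part algebra_simps)
qed

text \<open>On a sheet of a two-sheeted hyperboloid the time coordinate is a strictly 1-Lipschitz
  function of the space part, so any chord of the sheet is spacelike. This is the reversed
  Cauchy-Schwarz inequality.\<close>
lemma mink_less_of_same_square:
  assumes X: "X \<in> chron_future" and Y: "Y \<in> chron_future" and eq: "mink X X = mink Y Y" and "X \<noteq> Y"
  shows "mink X Y < mink X X"
proof -
  let ?x = "space_part X" and ?y = "space_part Y" and ?s = "X $ None" and ?t = "Y $ None"
  have st: "?s > 0" "?t > 0" using X Y by (auto simp: chron_future_time_pos)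
  have prod: "(?s - ?t) * (?s + ?t) = (?x - ?y) \<bullet> (?x + ?y)"
    using eq by (simp add: mink_space_part algebra_simps inner_commute)
  have ne: "?x \<noteq> ?y"
  proof
    assume "?x = ?y"
    with prod st have "?s = ?t" by auto
    with \<open>?x = ?y\<close> \<open>X \<noteq> Y\<close> show False by (blast intro: mink_eqI)
  qed
  have "\<bar>?s - ?t\<bar> * (?s + ?t) = \<bar>(?x - ?y) \<bullet> (?x + ?y)\<bar>"
    using st prod by (metis abs_mult abs_of_pos add_pos_pos)
  also have "\<dots> \<le> norm (?x - ?y) * norm (?x + ?y)" by (rule Cauchy_Schwarz_ineq2)
  also have "\<dots> < norm (?x - ?y) * (?s + ?t)"
    using ne X Y norm_triangle_ineq[of ?x ?y] by (auto simp: chron_future_iff)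
  finally have "\<bar>?s - ?t\<bar> < norm (?x - ?y)" using st by simp
  then have "(?s - ?t)\<^sup>2 < (norm (?x - ?y))\<^sup>2"
    by (metis abs_ge_zero power2_abs power_strict_mono zero_less_numeral)
  then have "mink (X - Y) (X - Y) > 0" by (simp add: mink_self)
  then show ?thesis using eq by (simp add: mink_bilinear mink_sym)
qed

lemma mink_le_of_same_square:
  assumes "X \<in> chron_future" "Y \<in> chron_future" "mink X X = mink Y Y"
  shows "mink X Y \<le> mink X X"
  using mink_less_of_same_square[OF assms] by (cases "X = Y") auto

text \<open>The inequality is tested on future vectors close to the null vector \<open>event (sgn y) 1\<close>, where \<open>y\<close> is
  the space part of \<open>Y\<close>.\<close>
lemma causal_of_mink_chron_future_le:
  assumes "\<And>X. X \<in> chron_future \<Longrightarrow> mink X Y \<le> 0"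
  shows "norm (space_part Y) \<le> Y $ None"
proof (rule field_le_epsilon)
  fix e :: real assume e: "e > 0"
  define y where "y = space_part Y"
  define r where "r = e / (\<bar>Y $ None\<bar> + 1)"
  have r: "r > 0" "r * \<bar>Y $ None\<bar> \<le> e" using e by (auto simp: r_def field_simps)
  have *: "r * Y $ None \<le> e" using r by (smt (verit) mult_left_mono abs_ge_self)
  have "event (sgn y) (1 + r) \<in> chron_future"
    using r by (simp add: chron_future_iff norm_sgn)
  from assms[OF this] have "sgn y \<bullet> y - (1 + r) * Y $ None \<le> 0"
    by (simp add: mink_space_part y_def)
  moreover have "sgn y \<bullet> y = norm y"
    by (cases "y = 0") (simp_all add: sgn_div_norm dot_square_norm power2_eq_square)
  ultimately show "norm (space_part Y) \<le> Y $ None + e"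
    using * by (simp add: y_def algebra_simps)
qed

lemma causal_time_pos:
  assumes "norm (space_part Y) \<le> Y $ None" "Y \<noteq> 0"
  shows "Y $ None > 0"
  using mink_chron_future_causal_neg[OF event_0_1_chron_future assms]
  by (simp add: mink_space_part)

lemma mink_null_neg:
  assumes "norm (space_part X) = 1" "X $ None = 1" "norm (space_part Y) = 1" "Y $ None = 1" "X \<noteq> Y"
  shows "mink X Y < 0"
proof -
  have "space_part X \<noteq> space_part Y" using assms mink_eqI[of X Y] by auto
  then have "0 < (space_part X - space_part Y) \<bullet> (space_part X - space_part Y)"
    by (simp only: inner_gt_zero_iff right_minus_eq not_False_eq_True)
  also have "\<dots> = 2 - 2 * (space_part X \<bullet> space_part Y)"
    using assms dot_square_norm[of "space_part X"] dot_square_norm[of "space_part Y"]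
    by (simp add: inner_diff inner_commute del: inner_eq_zero_iff)
  finally show ?thesis using assms by (simp add: mink_space_part)
qed

section \<open>Lorentz transformations\<close>

lemma time_reflect_linear: "linear time_reflect"
  by (rule linearI; rule mink_eqI) (simp_all add: time_reflect_def)

definition reflect_mat :: "'d::finite mink_mat" where
  "reflect_mat = matrix time_reflect"

lemma reflect_mat_mult [simp]: "reflect_mat *v X = time_reflect X"
  unfolding reflect_mat_def by (rule fun_cong[OF matrix_vector_mul(2)[OF time_reflect_linear]])

lemma reflect_mat_square: "reflect_mat ** reflect_mat = mat 1"
  by (simp add: matrix_eq matrix_vector_mul_assoc[symmetric])

lemma SO_plus_mink: "A \<in> SO_plus \<Longrightarrow> mink (A *v X) (A *v Y) = mink X Y"
  by (simp add: SO_plus_def)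

lemma SO_plus_chron_future: "A \<in> SO_plus \<Longrightarrow> X \<in> chron_future \<Longrightarrow> A *v X \<in> chron_future"
  by (auto simp: SO_plus_def)

lemma SO_plus_transpose:
  assumes "A \<in> SO_plus"
  shows "transpose A ** reflect_mat ** A = reflect_mat"
proof -
  have "X \<bullet> ((transpose A ** reflect_mat ** A) *v Y) = X \<bullet> (reflect_mat *v Y)" for X Y
  proof -
    have "X \<bullet> ((transpose A ** reflect_mat ** A) *v Y) = (A *v X) \<bullet> time_reflect (A *v Y)"
      by (simp add: matrix_vector_mul_assoc[symmetric] dot_lmul_matrix[symmetric]
          vector_transpose_matrix)
        (simp add: dot_lmul_matrix inner_commute[of X] inner_commute[of "A *v X"])
    also have "\<dots> = mink X Y" using assms by (simp add: mink_inner[symmetric] SO_plus_mink)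
    finally show ?thesis by (simp add: mink_inner)
  qed
  then have "(transpose A ** reflect_mat ** A) *v Y = reflect_mat *v Y" for Y
    using vector_eq_ldot by blast
  then show ?thesis unfolding matrix_eq by blast
qed

lemma SO_plus_det: "A \<in> SO_plus \<Longrightarrow> \<bar>det A\<bar> = 1"
proof -
  assume A: "A \<in> SO_plus"
  have "det (reflect_mat :: 'a mink_mat) * det (reflect_mat :: 'a mink_mat) = 1"
    by (metis det_I det_mul reflect_mat_square)
  then have "det (reflect_mat :: 'a mink_mat) \<noteq> 0" by auto
  moreover have "det A * det (reflect_mat :: 'a mink_mat) * det A = det (reflect_mat :: 'a mink_mat)"
    by (metis A SO_plus_transpose det_mul det_transpose)
  ultimately have "det A * det A = 1" by (simp add: algebra_simps)
  then show ?thesis by (metis abs_mult_self_eq abs_1 abs_square_eq_1 power2_eq_square)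
qed

lemma matrix_inv_SO_plus:
  assumes "A \<in> SO_plus"
  shows "A ** matrix_inv A = mat 1" "matrix_inv A ** A = mat 1"
proof -
  have "invertible A" using assms by (simp add: invertible_det_nz SO_plus_def)
  then have "\<exists>B. A ** B = mat 1 \<and> B ** A = mat 1" by (simp add: invertible_def)
  from someI_ex[OF this] show "A ** matrix_inv A = mat 1" "matrix_inv A ** A = mat 1"
    by (simp_all add: matrix_inv_def)
qed

lemma matrix_inv_SO_plus_mult [simp]:
  assumes "A \<in> SO_plus"
  shows "A *v (matrix_inv A *v X) = X" "matrix_inv A *v (A *v X) = X"
  using matrix_inv_SO_plus[OF assms] by (simp_all add: matrix_vector_mul_assoc)

lemma mink_matrix_inv: "A \<in> SO_plus \<Longrightarrow> mink (matrix_inv A *v X) Y = mink X (A *v Y)"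
  by (metis SO_plus_mink matrix_inv_SO_plus_mult(1))

text \<open>A Lorentz transformation is controlled by the image of a single timelike vector \<open>v\<close>: the
  image of another future vector keeps its product with that of \<open>v\<close> and so is bounded, and the
  future timelike vectors span the space.\<close>
lemma SO_plus_bounded:
  fixes v :: "'d::finite mink"
  assumes v: "v \<in> chron_future"
  obtains C where "\<And>A. A \<in> SO_plus \<Longrightarrow> norm (A *v v) \<le> M \<Longrightarrow> norm A \<le> C"
proof -
  have fut: "norm (A *v w) \<le> 4 * M * (- mink w v) / (- mink v v)"
    if A: "A \<in> SO_plus" "norm (A *v v) \<le> M" and w: "w \<in> chron_future" for A and w :: "'d mink"
  proof -
    define y where "y = A *v v"
    define z where "z = A *v w"
    have yz: "y \<in> chron_future" "z \<in> chron_future"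
      using A v w by (auto simp: y_def z_def SO_plus_chron_future)
    define a where "a = norm (space_part y)"
    have a: "0 \<le> a" "a < y $ None" using yz by (auto simp: a_def chron_future_iff)
    have yM: "y $ None \<le> M"
      using A component_le_norm_cart[of y None] by (simp add: y_def)
    have q: "- mink v v = (y $ None - a) * (y $ None + a)"
      using SO_plus_mink[OF A(1), of v v] mink_self[of y]
      by (simp add: y_def[symmetric] a_def power2_eq_square algebra_simps)
    have 1: "norm z * (y $ None - a) \<le> 2 * - mink w v"
      using norm_le_mink_chron_future[of y z] yz SO_plus_mink[OF A(1), of w v]
      by (simp add: y_def[symmetric] z_def[symmetric] a_def chron_future_iff)
    have "norm z * (- mink v v) = (norm z * (y $ None - a)) * (y $ None + a)"
      by (simp add: q)
    also have "\<dots> \<le> (2 * - mink w v) * (2 * M)"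
      using a yM mink_chron_future_neg[OF w v] by (intro mult_mono[OF 1]) auto
    finally show ?thesis
      using chron_future_mink_neg[OF v] by (simp add: z_def field_simps)
  qed
  have "\<exists>c. \<forall>A\<in>SO_plus. norm (A *v v) \<le> M \<longrightarrow> norm (A *v w) \<le> c" for w :: "'d mink"
  proof -
    define s where "s = norm w + 1"
    define e :: "'d mink" where "e = s *\<^sub>R event 0 1"
    have "s > 0" by (simp add: s_def add_nonneg_pos)
    then have e: "e \<in> chron_future"
      unfolding e_def using chron_future_scale[OF event_0_1_chron_future] by blast
    have "\<bar>w $ None\<bar> \<le> norm w" by (rule component_le_norm_cart)
    have "w + (2 * s) *\<^sub>R event 0 1 \<in> chron_future"
      using norm_space_part_le[of w] \<open>\<bar>w $ None\<bar> \<le> norm w\<close>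
      by (simp add: chron_future_iff s_def algebra_simps)
    moreover have "(2 * s) *\<^sub>R event 0 1 = 2 *\<^sub>R e" by (simp add: e_def)
    ultimately have e2: "w + 2 *\<^sub>R e \<in> chron_future" by simp
    show ?thesis
    proof (intro exI ballI impI)
      fix A assume A: "A \<in> (SO_plus :: 'd mink_mat set)" "norm (A *v v) \<le> M"
      have "A *v w = A *v (w + 2 *\<^sub>R e) - 2 *\<^sub>R (A *v e)"
        by (simp add: matrix_vector_right_distrib matrix_vector_mult_scaleR)
      then have "norm (A *v w) \<le> norm (A *v (w + 2 *\<^sub>R e)) + 2 * norm (A *v e)"
        by (metis norm_scaleR norm_triangle_ineq4 abs_numeral)
      also have "\<dots> \<le> 4 * M * (- mink (w + 2 *\<^sub>R e) v) / (- mink v v) + 2 * (4 * M * (- mink e v) / (- mink v v))"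
        using fut[OF A e2] fut[OF A e] by linarith
      finally show "norm (A *v w) \<le> \<dots>" .
    qed
  qed
  then obtain c where c: "\<And>w A. A \<in> SO_plus \<Longrightarrow> norm (A *v v) \<le> M \<Longrightarrow> norm (A *v w) \<le> c w"
    by metis
  have "norm A \<le> (\<Sum>i\<in>(UNIV :: 'd option set). \<Sum>j\<in>UNIV. c (axis j 1))"
    if A: "A \<in> SO_plus" "norm (A *v v) \<le> M" for A
  proof -
    have "norm A \<le> (\<Sum>i\<in>UNIV. norm (A $ i))"
      unfolding norm_vec_def by (rule L2_set_le_sum) simp
    also have "\<dots> \<le> (\<Sum>i\<in>UNIV. \<Sum>j\<in>UNIV. \<bar>A $ i $ j\<bar>)"
      by (intro sum_mono norm_le_l1_cart)
    also have "\<dots> \<le> (\<Sum>i\<in>(UNIV :: 'd option set). \<Sum>j\<in>UNIV. c (axis j 1))"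
    proof (intro sum_mono)
      fix i j :: "'d option"
      have "A $ i $ j = (A *v axis j 1) $ i" by (simp add: matrix_vector_mult_basis column_def)
      also have "\<bar>\<dots>\<bar> \<le> norm (A *v axis j 1)" by (rule component_le_norm_cart)
      also have "\<dots> \<le> c (axis j 1)" by (rule c[OF A])
      finally show "\<bar>A $ i $ j\<bar> \<le> c (axis j 1)" .
    qed
    finally show ?thesis .
  qed
  then show ?thesis using that by blast
qed

lemma SO_plus_causal:
  assumes "A \<in> SO_plus" "matrix_inv A \<in> SO_plus" "norm (space_part Y) \<le> Y $ None"
  shows "norm (space_part (A *v Y)) \<le> (A *v Y) $ None"
proof (rule causal_of_mink_chron_future_le)
  fix X :: "'a mink" assume "X \<in> chron_future"
  then have "matrix_inv A *v X \<in> chron_future" by (rule SO_plus_chron_future[OF assms(2)])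
  then have "mink (matrix_inv A *v X) Y \<le> 0"
    using mink_chron_future_causal_neg[OF _ assms(3)] by (cases "Y = 0") (force simp: mink_bilinear)+
  then show "mink X (A *v Y) \<le> 0" using assms by (simp add: mink_matrix_inv)
qed

section \<open>Uniform lattices\<close>

locale lattice =
  fixes \<Gamma> :: "'d::finite mink_mat set"
  assumes uniform: "uniform_lattice \<Gamma>"
begin

lemma \<Gamma>_SO_plus [simp, intro]: "g \<in> \<Gamma> \<Longrightarrow> g \<in> SO_plus"
  and one_\<Gamma> [simp, intro]: "mat 1 \<in> \<Gamma>"
  and mult_\<Gamma> [simp, intro]: "g \<in> \<Gamma> \<Longrightarrow> h \<in> \<Gamma> \<Longrightarrow> g ** h \<in> \<Gamma>"
  and inv_\<Gamma> [simp, intro]: "g \<in> \<Gamma> \<Longrightarrow> matrix_inv g \<in> \<Gamma>"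
  and discrete_\<Gamma>: "discrete \<Gamma>"
  and compact_quotient: "compact_space (hyp_quotient \<Gamma>)"
  using uniform by (auto simp: uniform_lattice_def)

text \<open>A point of accumulation \<open>l\<close> would make the products \<open>\<alpha>\<^sup>-\<^sup>1 \<beta>\<close> of nearby elements accumulate
  at the identity. The inverse is written by transposition, to be continuous in \<open>\<alpha>\<close>.\<close>
lemma finite_of_bounded:
  assumes "S \<subseteq> \<Gamma>" "bounded S"
  shows "finite S"
proof (rule ccontr)
  assume "infinite S"
  then obtain l where l: "l islimpt S" using bounded_infinite_imp_islimpt assms by blast
  define f :: "'d mink_mat \<times> 'd mink_mat \<Rightarrow> 'd mink_mat" where
    "f = (\<lambda>(a, b). reflect_mat ** transpose a ** reflect_mat ** b)"
  have fone: "f (a, b) = matrix_inv a ** b" if "a \<in> \<Gamma>" for a b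
  proof -
    have "reflect_mat ** transpose a ** reflect_mat ** a = mat 1"
      by (metis SO_plus_transpose \<Gamma>_SO_plus matrix_mul_assoc reflect_mat_square that)
    then have "reflect_mat ** transpose a ** reflect_mat = matrix_inv a"
      by (metis \<Gamma>_SO_plus matrix_inv_SO_plus(1) matrix_mul_assoc matrix_mul_lid matrix_mul_rid that)
    then show ?thesis by (simp add: f_def)
  qed
  have cont: "continuous_on UNIV f"
    unfolding f_def matrix_matrix_mult_def transpose_def case_prod_unfold
    by (intro continuous_intros)
  obtain r where r: "r > 0" "\<And>g. g \<in> \<Gamma> \<Longrightarrow> dist (mat 1) g < r \<Longrightarrow> g = mat 1"
    using isolated_inE_dist[OF discreteD[OF discrete_\<Gamma> one_\<Gamma>]] by metis
  have r2: "r / 2 > 0" using r by simp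
  from cont have "isCont f (l, l)" by (simp add: continuous_on_eq_continuous_at)
  then obtain \<delta> where \<delta>: "\<delta> > 0" "\<And>p. dist p (l, l) < \<delta> \<Longrightarrow> dist (f p) (f (l, l)) < r / 2"
    using r2 unfolding continuous_at_eps_delta by metis
  have "infinite (S \<inter> ball l (\<delta> / 2))" using l \<delta> by (simp add: islimpt_eq_infinite_ball)
  then obtain a where a: "a \<in> S" "a \<in> ball l (\<delta> / 2)" by (metis IntE ex_in_conv finite.emptyI)
  moreover obtain b where b: "b \<in> S" "b \<in> ball l (\<delta> / 2)" "b \<noteq> a"
    by (metis IntE \<open>infinite (S \<inter> ball l (\<delta> / 2))\<close> ex_new_if_finite finite.emptyI finite_insert
        finite_subset insertCI subsetI)
  have near: "dist (f (x, y)) (f (l, l)) < r / 2"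
    if "x \<in> ball l (\<delta> / 2)" "y \<in> ball l (\<delta> / 2)" for x y
  proof (rule \<delta>(2))
    have "dist (x, y) (l, l) \<le> dist x l + dist y l"
      unfolding dist_Pair_Pair by (rule sqrt_sum_squares_le_sum) auto
    then show "dist (x, y) (l, l) < \<delta>" using that by (simp add: dist_commute)
  qed
  have ab: "a \<in> \<Gamma>" "b \<in> \<Gamma>" using a b assms by auto
  have "f (a, a) = mat 1" using ab by (simp add: fone matrix_inv_SO_plus)
  then have "dist (mat 1) (f (a, b)) < r"
    using near[of a a] near[of a b] a b dist_triangle_half_l by metis
  then have "matrix_inv a ** b = mat 1" using r(2) ab by (simp add: fone)
  then have "b = a"
    by (metis \<Gamma>_SO_plus ab(1) matrix_inv_SO_plus(1) matrix_mul_assoc matrix_mul_lid matrix_mul_rid)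
  with b show False by simp
qed

lemma finite_bounded_orbit:
  assumes "v \<in> chron_future"
  shows "finite {g \<in> \<Gamma>. norm (g *v v) \<le> M}"
proof -
  obtain C where "\<And>A. A \<in> SO_plus \<Longrightarrow> norm (A *v v) \<le> M \<Longrightarrow> norm A \<le> C"
    using SO_plus_bounded[OF assms] by metis
  then have "bounded {g \<in> \<Gamma>. norm (g *v v) \<le> M}"
    unfolding bounded_iff by (intro exI[of _ C]) auto
  then show ?thesis by (intro finite_of_bounded) auto
qed

lemma countable_\<Gamma>: "countable \<Gamma>"
proof -
  have "finite {g \<in> \<Gamma>. norm g \<le> real n}" for n
    by (rule finite_of_bounded) (auto simp: bounded_iff)
  then have "countable (\<Union>n. {g \<in> \<Gamma>. norm g \<le> real n})"
    by (simp add: countable_finite)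
  moreover have "\<Gamma> \<subseteq> (\<Union>n. {g \<in> \<Gamma>. norm g \<le> real n})"
    using real_arch_simple by auto
  ultimately show ?thesis by (rule countable_subset[rotated])
qed

lemma matrix_inv_inv:
  assumes "g \<in> \<Gamma>"
  shows "matrix_inv (matrix_inv g) = g"
proof -
  have "matrix_inv g ** matrix_inv (matrix_inv g) = mat 1"
    using assms by (intro matrix_inv_SO_plus) auto
  then have "g ** (matrix_inv g ** matrix_inv (matrix_inv g)) = g" by simp
  then show ?thesis
    by (metis \<Gamma>_SO_plus assms matrix_inv_SO_plus(1) matrix_mul_assoc matrix_mul_lid)
qed

text \<open>The neighbourhoods \<open>{Z. \<exists>g\<in>\<Gamma>. - \<langle>Z, g v\<rangle> < n}\<close> of the orbit of \<open>v\<close> are open, invariant and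
  exhaust hyperbolic space, so finitely many of them cover the compact quotient.\<close>
lemma cocompact:
  assumes v: "v \<in> chron_future"
  obtains R where "\<And>Z. Z \<in> hyp \<Longrightarrow> \<exists>g\<in>\<Gamma>. - mink Z (g *v v) \<le> R"
proof -
  define V where "V n = {Z \<in> hyp. \<exists>g\<in>\<Gamma>. - mink Z (g *v v) < real n}" for n :: nat
  have inv: "Z' \<in> V n" if "Z \<in> V n" "Z' \<in> hyp" "orbit \<Gamma> Z' = orbit \<Gamma> Z"
    for Z Z' :: "'d mink" and n
  proof -
    have "Z' \<in> orbit \<Gamma> Z'" unfolding orbit_def by (rule image_eqI[of _ _ "mat 1"]) auto
    then have "Z' \<in> orbit \<Gamma> Z" using that by simp
    then obtain h where h: "h \<in> \<Gamma>" "Z' = h *v Z" unfolding orbit_def by blast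
    have "\<exists>g\<in>\<Gamma>. - mink Z (g *v v) < real n" using that(1) by (simp add: V_def)
    then obtain g where g: "g \<in> \<Gamma>" "- mink Z (g *v v) < real n" by blast
    have "mink Z' ((h ** g) *v v) = mink Z (g *v v)"
      using h by (simp add: matrix_vector_mul_assoc[symmetric] SO_plus_mink)
    then have "- mink Z' ((h ** g) *v v) < real n" using g by simp
    moreover have "h ** g \<in> \<Gamma>" using h g by simp
    ultimately show ?thesis using that(2) unfolding V_def by blast
  qed
  have pre: "{X \<in> hyp. orbit \<Gamma> X \<in> orbit \<Gamma> ` V n} = V n" for n
  proof -
    have "V n \<subseteq> hyp" by (auto simp: V_def)
    then show ?thesis using inv by blast
  qed
  have "openin (top_of_set hyp) (V n)" for n
  proof -
    have "open {Z. - mink Z (g *v v) < real n}" for g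
      by (intro open_Collect_less continuous_intros)
    then have "open (\<Union>g\<in>\<Gamma>. {Z. - mink Z (g *v v) < real n})" by blast
    moreover have "V n = hyp \<inter> (\<Union>g\<in>\<Gamma>. {Z. - mink Z (g *v v) < real n})" by (auto simp: V_def)
    ultimately show ?thesis by (simp add: openin_open_Int)
  qed
  then have op: "openin (hyp_quotient \<Gamma>) (orbit \<Gamma> ` V n)" for n
    unfolding openin_hyp_quotient pre by (auto simp: V_def)
  have top: "topspace (hyp_quotient \<Gamma>) = (\<Union>n. orbit \<Gamma> ` V n)"
  proof
    show "topspace (hyp_quotient \<Gamma>) \<subseteq> (\<Union>n. orbit \<Gamma> ` V n)"
    proof
      fix p assume "p \<in> topspace (hyp_quotient \<Gamma>)"
      then obtain Z where Z: "Z \<in> hyp" "p = orbit \<Gamma> Z"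
        unfolding topspace_def openin_hyp_quotient by blast
      obtain n :: nat where "- mink Z (mat 1 *v v) < real n" using reals_Archimedean2 by blast
      then have "Z \<in> V n" using Z unfolding V_def by blast
      then show "p \<in> (\<Union>n. orbit \<Gamma> ` V n)" using Z by blast
    qed
  qed (use op openin_subset in blast)
  obtain \<F> where \<F>: "finite \<F>" "\<F> \<subseteq> range (\<lambda>n. orbit \<Gamma> ` V n)" "topspace (hyp_quotient \<Gamma>) \<subseteq> \<Union>\<F>"
    using compact_quotient[unfolded compact_space_alt, rule_format, of "range (\<lambda>n. orbit \<Gamma> ` V n)"]
      op top by auto
  then obtain N where N: "finite N" "\<F> = (\<lambda>n. orbit \<Gamma> ` V n) ` N"
    by (meson finite_subset_image)
  have "\<exists>g\<in>\<Gamma>. - mink Z (g *v v) \<le> real (Max N)" if Z: "Z \<in> hyp" for Z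
  proof -
    obtain n0 :: nat where "- mink Z (mat 1 *v v) < real n0" using reals_Archimedean2 by blast
    then have "Z \<in> V n0" using Z unfolding V_def by blast
    then have "orbit \<Gamma> Z \<in> \<Union>\<F>" using \<F>(3) top by blast
    then obtain n where n: "n \<in> N" "orbit \<Gamma> Z \<in> orbit \<Gamma> ` V n" using N by blast
    then have "Z \<in> V n" using pre[of n] Z by blast
    then obtain g where "g \<in> \<Gamma>" "- mink Z (g *v v) < real n" unfolding V_def by blast
    moreover have "n \<le> Max N" using n N by simp
    ultimately show ?thesis by (intro bexI[of _ g]) auto
  qed
  then show ?thesis using that by blast
qed

end

section \<open>Orbits of a uniform lattice\<close>

context lattice
begin

text \<open>Along the geodesic ray from \<open>event 0 1\<close> towards the null direction \<open>n\<close>, orbit points at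
  bounded hyperbolic distance get arbitrarily deep into every horoball centred at \<open>n\<close>.\<close>
lemma orbit_near_null:
  assumes v: "v \<in> chron_future" and n: "norm (space_part n) = 1" "n $ None = 1" and e: "e > 0"
  obtains g where "g \<in> \<Gamma>" "- mink n (g *v v) \<le> e"
proof -
  obtain R where R: "\<And>Z. Z \<in> hyp \<Longrightarrow> \<exists>g\<in>\<Gamma>. - mink Z (g *v v) \<le> R"
    using cocompact[OF v] by metis
  \<comment> \<open>The choice of \<open>s\<close> makes \<open>R sqrt (1 + 2 s) \<le> e s\<close>; the root is the length of \<open>event 0 1 + s n\<close>.\<close>
  define u where "u = 1 + 2 * \<bar>R\<bar> / e"
  have u: "u \<ge> 1" "2 * \<bar>R\<bar> \<le> e * u" using e by (auto simp: u_def field_simps)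
  define s where "s = u\<^sup>2"
  have s: "s \<ge> 1" using u by (simp add: s_def)
  define c where "c = sqrt (1 + 2 * s)"
  have c: "c > 0" "c\<^sup>2 = 1 + 2 * s" using s by (auto simp: c_def)
  have cu: "c \<le> 2 * u"
    by (rule power2_le_imp_le) (use c s u in \<open>auto simp: power_mult_distrib simp flip: s_def\<close>)
  define Z where "Z = (1 / c) *\<^sub>R (event 0 1 + s *\<^sub>R n)"
  have nn: "mink n n = 0" using n by (simp add: mink_self)
  have "mink Z Z = (1 / c)\<^sup>2 * (- (1 + 2 * s))"
    using n by (simp add: Z_def mink_bilinear nn power2_eq_square)
      (simp add: mink_space_part diff_divide_distrib[symmetric])
  also have "\<dots> = -1" using c s by (simp add: power_divide divide_eq_eq)
  finally have "Z \<in> hyp" using c s n by (simp add: hyp_def Z_def)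
  then obtain g where g: "g \<in> \<Gamma>" "- mink Z (g *v v) \<le> R" using R by blast
  have "(g *v v) $ None > 0"
    using g v by (auto intro: chron_future_time_pos SO_plus_chron_future)
  moreover have "c * (- mink Z (g *v v)) = (g *v v) $ None + s * (- mink n (g *v v))"
    using c by (simp add: Z_def mink_bilinear) (simp add: mink_space_part algebra_simps)
  moreover have "c * (- mink Z (g *v v)) \<le> c * R" using mult_left_mono[OF g(2), of c] c by simp
  ultimately have "s * (- mink n (g *v v)) \<le> c * R" by linarith
  also have "\<dots> \<le> c * \<bar>R\<bar>" using c by (intro mult_left_mono) auto
  also have "\<dots> \<le> (2 * u) * \<bar>R\<bar>" using cu by (intro mult_right_mono) auto
  also have "\<dots> \<le> u * (e * u)"
    using u mult_left_mono[of "2 * \<bar>R\<bar>" "e * u" u] by simp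
  also have "\<dots> = s * e" by (simp add: s_def power2_eq_square)
  finally have "s * (- mink n (g *v v)) \<le> s * e" .
  then have "- mink n (g *v v) \<le> e" by (rule mult_left_le_imp_le) (use s in simp)
  then show ?thesis using g that by blast
qed

text \<open>A future timelike vector \<open>x\<close> of given square for which \<open>- \<langle>n, x\<rangle>\<close> is small is itself large and nearly
  parallel to \<open>n\<close>.\<close>
lemma orbit_direction:
  assumes v: "v \<in> chron_future" and n: "norm (space_part n) = 1" "n $ None = 1" and d: "d > 0"
  obtains g where "g \<in> \<Gamma>" "norm ((1 / (g *v v) $ None) *\<^sub>R (g *v v) - n) \<le> d"
    "1 / d \<le> (g *v v) $ None"
proof -
  define q where "q = sqrt (- mink v v)"
  have q: "q > 0" "q\<^sup>2 = - mink v v"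
    using chron_future_mink_neg[OF v] by (auto simp: q_def)
  define e where "e = min (d\<^sup>2 * q / 2) (q\<^sup>2 * d / 2)"
  have e: "e > 0" "2 * e \<le> d\<^sup>2 * q" "2 * e \<le> q\<^sup>2 * d"
    using q(1) d by (auto simp: e_def min_def)
  obtain g where g: "g \<in> \<Gamma>" "- mink n (g *v v) \<le> e" using orbit_near_null[OF v n e(1)] by metis
  define x where "x = g *v v"
  define s where "s = x $ None"
  define t where "t = s - space_part n \<bullet> space_part x"
  have x: "x \<in> chron_future" using g v by (auto simp: x_def SO_plus_chron_future)
  have s: "s > 0" "norm (space_part x) < s"
    using x by (auto simp: s_def chron_future_time_pos chron_future_iff)
  have t: "t \<le> e" using g n by (simp add: t_def s_def x_def[symmetric] mink_space_part)
  have qs: "q\<^sup>2 = s\<^sup>2 - (norm (space_part x))\<^sup>2"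
    using SO_plus_mink[of g v v] g q mink_self[of x] by (simp add: x_def[symmetric] s_def)
  have "q \<le> s"
    by (rule power2_le_imp_le) (use qs s in auto)
  have inner: "space_part n \<bullet> space_part x \<le> norm (space_part x)"
    using norm_cauchy_schwarz[of "space_part n" "space_part x"] n by simp
  have "q\<^sup>2 = (s - norm (space_part x)) * (s + norm (space_part x))"
    using qs by (simp add: power2_eq_square algebra_simps)
  also have "\<dots> \<le> t * (2 * s)"
    using inner s by (intro mult_mono) (auto simp: t_def)
  also have "\<dots> \<le> e * (2 * s)" using t s by (intro mult_right_mono) auto
  finally have "q\<^sup>2 * 1 \<le> (2 * e) * s" by simp
  also have "\<dots> \<le> (q\<^sup>2 * d) * s" using e s by (intro mult_right_mono) auto
  also have "\<dots> = q\<^sup>2 * (d * s)" by simp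
  finally have "q\<^sup>2 * 1 \<le> q\<^sup>2 * (d * s)" .
  then have "1 \<le> d * s" using mult_le_cancel_left_pos[of "q\<^sup>2"] q(1) by simp
  then have far: "1 / d \<le> s" using d by (simp add: field_simps)
  define w where "w = (1 / s) *\<^sub>R x - n"
  have "w $ None = 0" using s n by (simp add: w_def s_def)
  then have "(norm w)\<^sup>2 = (norm (space_part w))\<^sup>2" by (simp add: norm_space_time)
  also have "\<dots> = (norm (space_part x))\<^sup>2 / s\<^sup>2 - 2 * (space_part n \<bullet> space_part x) / s + 1"
  proof -
    have "(norm (space_part w))\<^sup>2 = space_part w \<bullet> space_part w" by (simp only: dot_square_norm)
    also have "\<dots> = (space_part x \<bullet> space_part x) / s\<^sup>2 - 2 * (space_part n \<bullet> space_part x) / s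
        + space_part n \<bullet> space_part n"
      by (simp add: w_def inner_diff inner_commute[of "space_part x" "space_part n"]
          power2_eq_square diff_divide_distrib)
    finally show ?thesis using n by (simp add: dot_square_norm)
  qed
  also have "\<dots> \<le> 2 * t / s"
  proof -
    have "(norm (space_part x))\<^sup>2 / s\<^sup>2 \<le> 1"
      using s qs by (simp add: divide_le_eq)
    then show ?thesis using s by (simp add: t_def field_simps)
  qed
  also have "\<dots> \<le> 2 * e / q"
    using t e q \<open>q \<le> s\<close> s by (intro frac_le) auto
  also have "\<dots> \<le> d\<^sup>2" using e q by (simp add: field_simps)
  finally have "norm w \<le> d" using d by (meson less_imp_le power2_le_imp_le)
  then show ?thesis using that[of g] g far unfolding w_def s_def x_def by blast
qed

text \<open>Otherwise a hyperplane, with normal \<open>Y\<close>, would separate the convex cone \<open>C\<close> from a point of the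
  future cone. The open half space beyond it contains a null direction, hence also orbit points.\<close>
lemma chron_future_subset_cone:
  assumes v: "v \<in> chron_future"
    and add: "\<And>x y. x \<in> C \<Longrightarrow> y \<in> C \<Longrightarrow> x + y \<in> C"
    and scale: "\<And>x c. x \<in> C \<Longrightarrow> c \<ge> 0 \<Longrightarrow> c *\<^sub>R x \<in> C"
    and orbit: "\<And>g. g \<in> \<Gamma> \<Longrightarrow> g *v v \<in> C"
  shows "chron_future \<subseteq> C"
proof
  fix w :: "'d mink" assume w: "w \<in> chron_future"
  show "w \<in> C"
  proof (rule ccontr)
    assume "w \<notin> C"
    have "convex C" unfolding convex_def using add scale by blast
    moreover have "C \<noteq> {}" using orbit[OF one_\<Gamma>] by blast
    ultimately obtain a b where ab: "a \<noteq> 0" "a \<bullet> w \<le> b" "\<And>x. x \<in> C \<Longrightarrow> b \<le> a \<bullet> x"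
      using separating_hyperplane_sets[of "{w}" C] \<open>w \<notin> C\<close> by auto
    have "b \<le> 0" using ab(3)[OF scale[OF orbit[OF one_\<Gamma>], of 0]] by simp
    have nonneg: "a \<bullet> x \<ge> 0" if x: "x \<in> C" for x
    proof (rule ccontr)
      assume neg: "\<not> a \<bullet> x \<ge> 0"
      define c where "c = (1 - b) / - (a \<bullet> x)"
      have "c \<ge> 0" using neg \<open>b \<le> 0\<close> by (simp add: c_def field_simps)
      then have "b \<le> a \<bullet> (c *\<^sub>R x)" by (intro ab(3) scale x)
      also have "\<dots> = b - 1" using neg by (simp add: c_def field_simps)
      finally show False by simp
    qed
    define Y where "Y = time_reflect a"
    have Y: "Y \<noteq> 0" "mink w Y \<le> 0" "\<And>g. g \<in> \<Gamma> \<Longrightarrow> mink (g *v v) Y \<ge> 0"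
      using ab(1,2) \<open>b \<le> 0\<close> nonneg[OF orbit]
      by (auto simp: Y_def mink_time_reflect inner_commute[of _ a] intro: order_trans)
    let ?y = "space_part Y"
    have yw: "?y \<bullet> space_part w \<le> Y $ None * w $ None"
      using Y(2) by (simp add: mink_space_part inner_commute mult.commute)
    have w0: "w $ None > 0" "norm (space_part w) < w $ None"
      using w by (auto simp: chron_future_time_pos chron_future_iff)
    obtain z where z: "norm z = 1" "?y \<bullet> z < Y $ None"
    proof (cases "?y = 0")
      case True
      then have "Y $ None \<noteq> 0" using Y(1) mink_eqI[of Y 0] by auto
      moreover have "0 \<le> Y $ None" using yw w0 True by (simp add: zero_le_mult_iff)
      ultimately have "?y \<bullet> axis undefined 1 < Y $ None" using True by simp
      then show ?thesis using that[of "axis undefined 1"] by simp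
    next
      case False
      have "- (norm ?y * w $ None) < - (norm ?y * norm (space_part w))"
        using False w0 by simp
      also have "\<dots> \<le> ?y \<bullet> space_part w"
        using Cauchy_Schwarz_ineq2[of ?y "space_part w"] by linarith
      finally have "(- norm ?y) * w $ None < Y $ None * w $ None" using yw by simp
      then have "- norm ?y < Y $ None" using w0 by (metis less_imp_le mult_right_less_imp_less)
      moreover have "?y \<bullet> - sgn ?y = - norm ?y"
        using False by (simp add: sgn_div_norm dot_square_norm power2_eq_square)
      ultimately show ?thesis using that[of "- sgn ?y"] False by (simp add: norm_sgn)
    qed
    define n where "n = event z 1"
    have n: "norm (space_part n) = 1" "n $ None = 1" "mink n Y < 0"
      using z by (auto simp: n_def mink_space_part inner_commute)
    define d where "d = - mink n Y / (2 * norm Y)"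
    have d: "d > 0" "d * norm Y = - mink n Y / 2"
      using n Y(1) by (auto simp: d_def divide_neg_pos)
    obtain g where g: "g \<in> \<Gamma>" "norm ((1 / (g *v v) $ None) *\<^sub>R (g *v v) - n) \<le> d"
      using orbit_direction[OF v n(1,2) d(1)] by metis
    let ?x = "g *v v"
    have x0: "?x $ None > 0"
      using g v by (auto intro: chron_future_time_pos SO_plus_chron_future)
    have "mink ((1 / ?x $ None) *\<^sub>R ?x - n) Y \<le> d * norm Y"
      using abs_mink_le[of "(1 / ?x $ None) *\<^sub>R ?x - n" Y] g(2)
        mult_right_mono[OF g(2), of "norm Y"] by simp
    then have "mink ?x Y / ?x $ None < 0"
      using d n by (simp add: mink_bilinear)
    then show False using Y(3)[OF g(1)] x0 by (simp add: divide_less_0_iff)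
  qed
qed

end

section \<open>No invariant null direction\<close>

lemma null_norm_eq:
  assumes "mink X X = 0" "norm (space_part X) \<le> X $ None"
  shows "norm (space_part X) = X $ None"
proof (rule power2_eq_imp_eq)
  show "0 \<le> X $ None" using assms(2) norm_ge_zero order_trans by blast
qed (use assms mink_self[of X] in auto)

lemma null_parallel:
  assumes "norm (space_part X) = X $ None" "norm (space_part Y) = Y $ None" "Y $ None > 0"
    and "X $ None > 0" "mink X Y = 0"
  shows "X = (X $ None / Y $ None) *\<^sub>R Y"
proof -
  define X' where "X' = (1 / X $ None) *\<^sub>R X"
  define Y' where "Y' = (1 / Y $ None) *\<^sub>R Y"
  have "mink X' Y' = 0" using assms by (simp add: X'_def Y'_def mink_bilinear)
  moreover have "norm (space_part X') = 1" "X' $ None = 1" "norm (space_part Y') = 1" "Y' $ None = 1"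
    using assms by (auto simp: X'_def Y'_def)
  ultimately have "X' = Y'" using mink_null_neg[of X' Y'] by force
  then have "(X $ None) *\<^sub>R X' = (X $ None) *\<^sub>R Y'" by simp
  then show ?thesis using assms by (simp add: X'_def Y'_def)
qed

text \<open>An isometry \<open>a\<close> of a nondegenerate form is conjugate to the transpose of its inverse, so its
  spectrum is invariant under inversion.\<close>
lemma SO_plus_dual_eigenvector:
  assumes a: "a \<in> SO_plus" and y: "y \<noteq> 0" "a *v y = \<mu> *\<^sub>R y" and mu: "\<mu> \<noteq> 0"
  obtains u where "u \<noteq> 0" "a *v u = (1 / \<mu>) *\<^sub>R u"
proof -
  define m where "m = a - (1 / \<mu>) *\<^sub>R mat 1"
  have app: "m *v x = a *v x - (1 / \<mu>) *\<^sub>R x" for x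
    by (simp add: m_def matrix_vector_mult_diff_rdistrib scaleR_matrix_vector_assoc[symmetric])
  have "transpose m = transpose a - (1 / \<mu>) *\<^sub>R mat 1"
    by (simp add: m_def transpose_def mat_def vec_eq_iff)
  then have appt: "transpose m *v x = transpose a *v x - (1 / \<mu>) *\<^sub>R x" for x
    by (simp add: matrix_vector_mult_diff_rdistrib scaleR_matrix_vector_assoc[symmetric])
  have "time_reflect y = (transpose a ** reflect_mat ** a) *v y"
    using SO_plus_transpose[OF a] by simp
  also have "\<dots> = transpose a *v (time_reflect (\<mu> *\<^sub>R y))"
    by (simp add: matrix_vector_mul_assoc[symmetric] y del: transpose_matrix_vector)
  also have "\<dots> = \<mu> *\<^sub>R (transpose a *v time_reflect y)"
    by (simp add: linear_scale[OF time_reflect_linear] matrix_vector_mult_scaleR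
        del: transpose_matrix_vector)
  finally have "(1 / \<mu>) *\<^sub>R time_reflect y = (1 / \<mu>) *\<^sub>R (\<mu> *\<^sub>R (transpose a *v time_reflect y))"
    by simp
  then have "transpose m *v time_reflect y = 0"
    using mu by (simp add: appt del: transpose_matrix_vector)
  moreover have "time_reflect y \<noteq> 0" using y by simp
  ultimately have "\<not> invertible (transpose m)"
    by (metis invertible_def matrix_left_invertible_ker)
  then have "\<not> invertible m" by (simp add: invertible_det_nz)
  then have "\<exists>x. m *v x = 0 \<and> x \<noteq> 0"
    using matrix_left_invertible_ker invertible_left_inverse by blast
  then obtain u where "u \<noteq> 0" "m *v u = 0" by blast
  then show ?thesis using that[of u] by (simp add: app)
qed

lemma exists_third_unit_vector:
  assumes "CARD('d::finite) \<ge> 2"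
  obtains z :: "real ^ 'd" where "norm z = 1" "z \<noteq> x" "z \<noteq> y"
proof -
  obtain i j :: 'd where ij: "i \<noteq> j"
    using assms by (metis One_nat_def card_2_iff' card_le_Suc0_iff_eq finite numeral_2_eq_2
        not_less_eq_eq UNIV_I)
  define e where "e k = (axis k 1 :: real ^ 'd)" for k
  have "e i \<noteq> e j" "e i \<noteq> - e i" "e j \<noteq> - e i"
    using ij by (auto simp: e_def axis_def vec_eq_iff)
  moreover have "norm (e i) = 1" "norm (e j) = 1" "norm (- e i) = 1" by (auto simp: e_def)
  ultimately show ?thesis using that by metis
qed

locale lattice_dim2 = lattice \<Gamma> for \<Gamma> :: "'d::finite mink_mat set" +
  assumes dim: "CARD('d) \<ge> 2"
begin

text \<open>If both null directions \<open>y\<close> and \<open>u\<close> are invariant, then \<open>\<langle>\<cdot>, y\<rangle> \<langle>\<cdot>, u\<rangle>\<close> is constant on the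
  orbits, which therefore cannot go to infinity in any third direction.\<close>
lemma no_invariant_null_pair:
  assumes y: "norm (space_part y) = 1" "y $ None = 1" and u: "norm (space_part u) = 1" "u $ None = 1"
    and "y \<noteq> u"
    and fixy: "\<And>g. g \<in> \<Gamma> \<Longrightarrow> \<exists>c. g *v y = c *\<^sub>R y" and fixu: "\<And>g. g \<in> \<Gamma> \<Longrightarrow> \<exists>c. g *v u = c *\<^sub>R u"
  shows False
proof -
  define v :: "'d mink" where "v = event 0 1"
  have v: "v \<in> chron_future" by (simp add: v_def event_0_1_chron_future)
  have yu: "mink y u < 0" using y u \<open>y \<noteq> u\<close> by (rule mink_null_neg)
  define k where "k = mink v y * mink v u"
  have k: "k = 1" using y u by (simp add: k_def v_def mink_space_part)
  have const: "mink (g *v v) y * mink (g *v v) u = k" if g: "g \<in> \<Gamma>" for g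
  proof -
    obtain c where c: "matrix_inv g *v y = c *\<^sub>R y" using fixy g by blast
    obtain b where b: "matrix_inv g *v u = b *\<^sub>R u" using fixu g by blast
    have "mink (matrix_inv g *v y) (matrix_inv g *v u) = mink y u" using g by (simp add: SO_plus_mink)
    then have "c * b = 1" using yu by (simp add: c b mink_bilinear mult.commute)
    have "mink (g *v v) y = c * mink v y"
      using mink_matrix_inv[of g y v] g by (simp add: c mink_sym[of _ y] mink_bilinear)
    moreover have "mink (g *v v) u = b * mink v u"
      using mink_matrix_inv[of g u v] g by (simp add: b mink_sym[of _ u] mink_bilinear)
    ultimately have "mink (g *v v) y * mink (g *v v) u = (c * b) * k" by (simp add: k_def)
    then show ?thesis using \<open>c * b = 1\<close> by simp
  qed
  obtain z where z: "norm z = 1" "z \<noteq> space_part y" "z \<noteq> space_part u"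
    using exists_third_unit_vector[OF dim] by blast
  define n where "n = event z 1"
  have n: "norm (space_part n) = 1" "n $ None = 1" using z by (auto simp: n_def)
  have "n \<noteq> y" "n \<noteq> u" using z by (auto simp: n_def)
  define \<alpha> where "\<alpha> = - mink n y"
  define \<beta> where "\<beta> = - mink n u"
  have pos: "\<alpha> > 0" "\<beta> > 0"
    using mink_null_neg[OF n y \<open>n \<noteq> y\<close>] mink_null_neg[OF n u \<open>n \<noteq> u\<close>] by (auto simp: \<alpha>_def \<beta>_def)
  \<comment> \<open>For an orbit point with time coordinate \<open>s \<ge> 1 / d\<close> and direction within \<open>d\<close> of \<open>n\<close>, the product of
    the two pairings is at least \<open>s\<^sup>2 \<alpha> \<beta> / 4\<close>, which exceeds its constant value 1.\<close>
  define d where "d = min 1 (min (\<alpha> / 4) (min (\<beta> / 4) (\<alpha> * \<beta> / 8)))"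
  have d: "d > 0" "d \<le> 1" "d \<le> \<alpha> / 4" "d \<le> \<beta> / 4" "d \<le> \<alpha> * \<beta> / 8"
    using pos by (auto simp: d_def)
  obtain g where g: "g \<in> \<Gamma>" "norm ((1 / (g *v v) $ None) *\<^sub>R (g *v v) - n) \<le> d"
    "1 / d \<le> (g *v v) $ None"
    using orbit_direction[OF v n d(1)] by metis
  define s where "s = (g *v v) $ None"
  define x where "x = (1 / s) *\<^sub>R (g *v v)"
  have "s > 0" using g v by (auto simp: s_def intro: chron_future_time_pos SO_plus_chron_future)
  have near: "- mink n w / 2 \<le> - mink x w" if w: "norm (space_part w) = 1" "w $ None = 1"
    "d \<le> - mink n w / 4" for w
  proof -
    have "norm w \<le> 2" by (rule power2_le_imp_le) (use w in \<open>auto simp: norm_space_time\<close>)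
    have "mink (x - n) w \<le> norm (x - n) * norm w" using abs_mink_le[of "x - n" w] by simp
    also have "\<dots> \<le> d * 2" using g(2) \<open>norm w \<le> 2\<close> d by (intro mult_mono) (auto simp: x_def s_def)
    finally show ?thesis using w by (simp add: mink_bilinear)
  qed
  have "\<alpha> / 2 * (\<beta> / 2) \<le> (- mink x y) * (- mink x u)"
    using near[OF y] near[OF u] d pos by (intro mult_mono) (auto simp: \<alpha>_def \<beta>_def)
  then have "s * (\<alpha> * \<beta> / 4) \<le> s * (mink x y * mink x u)" using \<open>s > 0\<close> by simp
  also have "\<dots> = k / s" using const[OF g(1)] \<open>s > 0\<close> by (simp add: x_def mink_bilinear)
  also have "\<dots> \<le> 1"
  proof -
    have "1 \<le> 1 / d" using d by simp
    then show ?thesis using k g(3) by (simp add: s_def)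
  qed
  finally have "s * (\<alpha> * \<beta> / 4) \<le> 1" .
  moreover have "2 \<le> s * (\<alpha> * \<beta> / 4)"
  proof -
    have "1 \<le> s * d" using g(3) d by (simp add: s_def field_simps)
    also have "\<dots> \<le> s * (\<alpha> * \<beta> / 8)" using d \<open>s > 0\<close> by (intro mult_left_mono) auto
    finally show ?thesis by simp
  qed
  ultimately show False by simp
qed

text \<open>If the direction of \<open>y\<close> were invariant, some \<open>a\<close> in the lattice would expand it, since orbits
  enter the horoballs at \<open>y\<close>. Let \<open>u\<close> span the null direction contracted by \<open>a\<close>. For any \<open>b\<close> in the
  lattice the conjugates of \<open>b\<close> by \<open>a\<^sup>n\<close> move \<open>y + u\<close> a bounded hyperbolic distance, so by
  discreteness two of them coincide, and this forces \<open>b\<close> to fix the direction of \<open>u\<close> too.\<close>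
lemma null_direction_moved:
  assumes y: "norm (space_part y) = 1" "y $ None = 1"
  shows "\<exists>g\<in>\<Gamma>. \<forall>c. g *v y \<noteq> c *\<^sub>R y"
proof (rule ccontr)
  assume "\<not> ?thesis"
  then have "\<forall>g\<in>\<Gamma>. \<exists>c. g *v y = c *\<^sub>R y" by simp
  then obtain \<mu> where \<mu>: "\<And>g. g \<in> \<Gamma> \<Longrightarrow> g *v y = \<mu> g *\<^sub>R y" unfolding bchoice_iff by blast
  define e :: "'d mink" where "e = event 0 1"
  have e: "e \<in> chron_future" "mink y e = -1"
    using y by (auto simp: e_def event_0_1_chron_future mink_space_part)
  have "y \<noteq> 0" using y by auto
  obtain a where a: "a \<in> \<Gamma>" "- mink y (a *v e) \<le> 1 / 2"
    using orbit_near_null[OF e(1) y, of "1 / 2"] by auto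
  define k where "k = - mink y (a *v e)"
  have "mink (a *v e) y < 0"
    using a e y \<open>y \<noteq> 0\<close> by (intro mink_chron_future_causal_neg SO_plus_chron_future) auto
  then have k: "0 < k" "k \<le> 1 / 2" using a by (auto simp: k_def mink_sym[of y])
  define m where "m = \<mu> a"
  have am: "a *v y = m *\<^sub>R y" using \<mu>[OF a(1)] by (simp add: m_def)
  have "m * k = 1"
    using SO_plus_mink[of a y e] a(1) e(2) by (simp add: am mink_bilinear k_def)
  then have "m = 1 / k" using k by (simp add: field_simps)
  then have "m > 1" using k by simp
  with am have m: "m > 1" "m \<noteq> 0" "m > 0" "a *v y = m *\<^sub>R y" by auto
  obtain u0 where u0: "u0 \<noteq> 0" "a *v u0 = (1 / m) *\<^sub>R u0"
    using SO_plus_dual_eigenvector[of a y m] a m \<open>y \<noteq> 0\<close> by auto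
  have "mink u0 u0 = (1 / m)\<^sup>2 * mink u0 u0"
    using SO_plus_mink[of a u0 u0] a u0 by (simp add: mink_bilinear power2_eq_square)
  moreover have "(1 / m)\<^sup>2 \<noteq> 1" using m(1) by (simp add: power_divide power2_eq_1_iff)
  ultimately have "mink u0 u0 = 0" by auto
  then have null: "\<bar>u0 $ None\<bar> = norm (space_part u0)"
    by (intro power2_eq_imp_eq[of "\<bar>u0 $ None\<bar>"]) (auto simp: mink_self)
  then have "u0 $ None \<noteq> 0" using u0(1) mink_eqI[of u0 0] by auto
  define u where "u = (1 / u0 $ None) *\<^sub>R u0"
  have u: "norm (space_part u) = 1" "u $ None = 1" "a *v u = (1 / m) *\<^sub>R u"
    using null \<open>u0 $ None \<noteq> 0\<close> u0 by (auto simp: u_def matrix_vector_mult_scaleR)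
  have "y \<noteq> u"
  proof
    assume "y = u"
    then have "m *\<^sub>R y = (1 / m) *\<^sub>R y" using u(3) m(4) by metis
    then have "m = 1 / m" using \<open>y \<noteq> 0\<close> by (metis scaleR_cancel_right)
    then have "m * m = 1" using m by (simp add: field_simps)
    then show False using m by (simp add: power2_eq_square[symmetric] power2_eq_1_iff)
  qed
  have yu: "mink y u < 0" using y u(1,2) \<open>y \<noteq> u\<close> by (rule mink_null_neg)
  have yuf: "y + u \<in> chron_future"
  proof -
    have "mink (y + u) (y + u) < 0"
      using yu y u by (simp add: mink_bilinear mink_sym[of u y] mink_self[of y] mink_self[of u])
    then show ?thesis using y u by (simp add: chron_future_def)
  qed
  have "\<exists>c. b *v u = c *\<^sub>R u" if b: "b \<in> \<Gamma>" for b
  proof -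
    define A where "A n = (((**) a) ^^ n) (mat 1)" for n :: nat
    have A: "A n \<in> \<Gamma>" for n by (induction n) (use a in \<open>auto simp: A_def\<close>)
    have Ay: "A n *v y = m ^ n *\<^sub>R y" for n
      by (induction n) (use m in \<open>auto simp: A_def matrix_vector_mul_assoc[symmetric] matrix_vector_mult_scaleR\<close>)
    have Au: "A n *v u = (1 / m) ^ n *\<^sub>R u" for n
      by (induction n) (use u in \<open>auto simp: A_def matrix_vector_mul_assoc[symmetric] matrix_vector_mult_scaleR\<close>)
    define B where "B n = matrix_inv (A n) ** (b ** A n)" for n
    have B: "B n \<in> \<Gamma>" for n using A b by (simp add: B_def)
    have minkB: "mink (B n *v x) x' = mink (b *v (A n *v x)) (A n *v x')" for n x x'
      using A by (simp add: B_def matrix_vector_mul_assoc[symmetric] mink_matrix_inv)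
    define \<nu> where "\<nu> = \<mu> b"
    have bmuly: "b *v y = \<nu> *\<^sub>R y" using \<mu> b by (simp add: \<nu>_def)
    define p where "p = mink (b *v u) u"
    have Buu: "mink (B n *v u) u = ((1 / m) ^ n)\<^sup>2 * p" for n
      by (simp add: minkB Au mink_bilinear matrix_vector_mult_scaleR power2_eq_square p_def)
    have Byu: "mink (B n *v y) u = \<nu> * mink y u" for n
      using m by (simp add: minkB Ay Au bmuly mink_bilinear matrix_vector_mult_scaleR power_divide)
    have Byy: "mink (B n *v y) y = 0" for n
      using y by (simp add: minkB Ay bmuly mink_bilinear matrix_vector_mult_scaleR mink_self)
    have Buy: "mink (B n *v u) y = mink (b *v u) y" for n
      using m by (simp add: minkB Ay Au bmuly mink_bilinear matrix_vector_mult_scaleR power_divide)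
    define K where "K = \<bar>\<nu> * mink y u\<bar> + \<bar>mink (b *v u) y\<bar> + \<bar>p\<bar>"
    define c where "c = (y + u) $ None - norm (space_part (y + u))"
    have c: "c > 0" using yuf by (simp add: c_def chron_future_iff)
    have "norm (B n *v (y + u)) \<le> 2 * K / c" for n
    proof -
      have "((1 / m) ^ n)\<^sup>2 \<le> 1" using m by (simp add: power_le_one)
      then have "\<bar>((1 / m) ^ n)\<^sup>2 * p\<bar> \<le> 1 * \<bar>p\<bar>" unfolding abs_mult by (intro mult_right_mono) auto
      then have "- mink (B n *v (y + u)) (y + u) \<le> K"
        by (simp add: matrix_vector_right_distrib mink_bilinear Buu Byu Byy Buy K_def)
      moreover have "B n *v (y + u) \<in> chron_future" using B yuf by (auto intro: SO_plus_chron_future)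
      then have "norm (B n *v (y + u)) * c \<le> 2 * - mink (B n *v (y + u)) (y + u)"
        unfolding c_def by (intro norm_le_mink_chron_future yuf) (auto simp: chron_future_iff)
      ultimately show ?thesis using c by (simp add: field_simps)
    qed
    then have "range B \<subseteq> {g \<in> \<Gamma>. norm (g *v (y + u)) \<le> 2 * K / c}" using B by auto
    then have "finite (range B)" using finite_bounded_orbit[OF yuf] finite_subset by blast
    then have "\<not> inj B" using finite_imageD infinite_UNIV_nat by blast
    then obtain i j where ij: "B i = B j" "i \<noteq> j" by (auto simp: inj_def)
    have "p = 0"
    proof (rule ccontr)
      assume "p \<noteq> 0"
      then have "((1 / m) ^ i)\<^sup>2 = ((1 / m) ^ j)\<^sup>2" using Buu[of i] Buu[of j] ij by simp
      then have "(1 / m) ^ i = (1 / m) ^ j" using m by (simp add: power2_eq_iff_nonneg)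
      then show False using m ij by (simp add: power_divide power_inject_exp)
    qed
    have bu: "norm (space_part (b *v u)) \<le> (b *v u) $ None"
      using b u by (intro SO_plus_causal) auto
    have "mink (b *v u) (b *v u) = mink u u" using b by (simp add: SO_plus_mink)
    then have n1: "norm (space_part (b *v u)) = (b *v u) $ None"
      using u mink_self[of u] bu by (intro null_norm_eq) auto
    have "u \<noteq> 0" using u by auto
    have "b *v u \<noteq> 0" using \<open>u \<noteq> 0\<close> b by (metis \<Gamma>_SO_plus matrix_inv_SO_plus_mult(2) matrix_vector_mult_0_right)
    then have "(b *v u) $ None > 0" using causal_time_pos bu by blast
    then have "b *v u = ((b *v u) $ None / u $ None) *\<^sub>R u"
      using u \<open>p = 0\<close> by (intro null_parallel[OF n1]) (simp_all add: p_def)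
    then show ?thesis by blast
  qed
  then show False
    using no_invariant_null_pair[OF y u(1,2) \<open>y \<noteq> u\<close>] \<mu> by blast
qed

end

section \<open>The maximal invariant convex set\<close>

lemma convex_comb_cancel:
  fixes p :: "'a::real_vector"
  shows "a + b = 1 \<Longrightarrow> a *\<^sub>R p + b *\<^sub>R p = p"
  by (simp add: scaleR_add_left[symmetric])

lemma aff_convex_comb:
  "a + b = 1 \<Longrightarrow> aff \<tau> g (a *\<^sub>R x + b *\<^sub>R y) = a *\<^sub>R aff \<tau> g x + b *\<^sub>R aff \<tau> g y"
  unfolding aff_def
  using convex_comb_cancel[of a b "\<tau> g"]
  by (simp add: matrix_vector_right_distrib matrix_vector_mult_scaleR scaleR_add_right algebra_simps)

lemma continuous_on_aff: "continuous_on S (aff \<tau> g)"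
  unfolding aff_def by (intro continuous_intros linear_continuous_on) simp

lemma convex_mink_halfspace: "convex {p. mink p v \<le> c}"
  using convex_halfspace_le[of "time_reflect v" c] by (simp add: mink_inner inner_commute)

lemma closed_mink_halfspace: "closed {p. mink p v \<le> c}"
  by (intro closed_Collect_le continuous_intros)

lemma future_closed:
  assumes "tau_convex \<Gamma> \<tau> K" "p \<in> K" "w \<in> chron_future"
  shows "p + w \<in> K"
proof -
  have "p + w \<in> K + chron_future" using assms(2,3) by (rule set_plus_intro)
  then show ?thesis using assms(1) unfolding tau_convex_def by blast
qed

locale affine_lattice = lattice_dim2 \<Gamma> for \<Gamma> :: "'d::finite mink_mat set" +
  fixes \<tau> :: "'d mink_mat \<Rightarrow> 'd mink"
  assumes cocycle: "cocycle \<Gamma> \<tau>"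
begin

lemma aff_mult: "g \<in> \<Gamma> \<Longrightarrow> h \<in> \<Gamma> \<Longrightarrow> aff \<tau> (g ** h) X = aff \<tau> g (aff \<tau> h X)"
  using cocycle
  by (simp add: aff_def cocycle_def matrix_vector_mul_assoc[symmetric] matrix_vector_right_distrib)

lemma aff_one [simp]: "aff \<tau> (mat 1) X = X"
proof -
  have "\<tau> (mat 1 ** mat 1) = \<tau> (mat 1) + mat 1 *v \<tau> (mat 1)"
    using cocycle one_\<Gamma> unfolding cocycle_def by blast
  then show ?thesis by (simp add: aff_def)
qed

lemma aff_inv [simp]:
  assumes "g \<in> \<Gamma>"
  shows "aff \<tau> (matrix_inv g) (aff \<tau> g X) = X" "aff \<tau> g (aff \<tau> (matrix_inv g) X) = X"
proof -
  have "aff \<tau> (matrix_inv g) (aff \<tau> g X) = aff \<tau> (matrix_inv g ** g) X"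
    "aff \<tau> g (aff \<tau> (matrix_inv g) X) = aff \<tau> (g ** matrix_inv g) X"
    using assms by (auto simp: aff_mult)
  then show "aff \<tau> (matrix_inv g) (aff \<tau> g X) = X" "aff \<tau> g (aff \<tau> (matrix_inv g) X) = X"
    using assms by (auto simp: matrix_inv_SO_plus)
qed

lemma mem_aff_image: "g \<in> \<Gamma> \<Longrightarrow> X \<in> aff \<tau> g ` S \<longleftrightarrow> aff \<tau> (matrix_inv g) X \<in> S"
  using aff_inv[of g] by (auto intro: image_eqI[of X _ "aff \<tau> (matrix_inv g) X"])

lemma aff_image_eqI:
  assumes "\<And>g X. g \<in> \<Gamma> \<Longrightarrow> X \<in> S \<Longrightarrow> aff \<tau> g X \<in> S" "g \<in> \<Gamma>"
  shows "aff \<tau> g ` S = S"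
proof
  show "aff \<tau> g ` S \<subseteq> S" using assms by blast
  show "S \<subseteq> aff \<tau> g ` S" using assms by (simp add: subset_iff mem_aff_image)
qed

lemma tau_convex_aff: "tau_convex \<Gamma> \<tau> K \<Longrightarrow> g \<in> \<Gamma> \<Longrightarrow> p \<in> K \<Longrightarrow> aff \<tau> g p \<in> K"
  unfolding tau_convex_def by blast

lemma mink_mult_right:
  assumes "g \<in> \<Gamma>"
  shows "mink p (g *v x) = mink (aff \<tau> (matrix_inv g) p) x - mink (\<tau> (matrix_inv g)) x"
  using assms by (simp add: aff_def mink_bilinear mink_matrix_inv)

text \<open>The directions in which a \<open>\<tau>\<close>-convex set is bounded above form an invariant convex cone, and
  it suffices to find one future timelike direction. A supporting direction is causal; if it is
  null, a translate of it is not parallel to it, and the sum of the two is timelike.\<close>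
lemma tau_convex_bounded_above:
  assumes K: "tau_convex \<Gamma> \<tau> K" and v: "v \<in> chron_future"
  shows "\<exists>c. \<forall>p\<in>K. mink p v \<le> c"
proof -
  define D where "D = {x. \<exists>c. \<forall>p\<in>K. mink p x \<le> c}"
  have D_add: "x + y \<in> D" if xy: "x \<in> D" "y \<in> D" for x y
  proof -
    obtain c d where "\<forall>p\<in>K. mink p x \<le> c" "\<forall>p\<in>K. mink p y \<le> d" using xy by (auto simp: D_def)
    then have "\<forall>p\<in>K. mink p (x + y) \<le> c + d" by (simp add: mink_bilinear add_mono)
    then show ?thesis unfolding D_def by blast
  qed
  have D_scale: "c *\<^sub>R x \<in> D" if x: "x \<in> D" "c \<ge> 0" for x c
  proof -
    obtain b where "\<forall>p\<in>K. mink p x \<le> b" using x by (auto simp: D_def)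
    then have "\<forall>p\<in>K. mink p (c *\<^sub>R x) \<le> c * b" using x by (simp add: mink_bilinear mult_left_mono)
    then show ?thesis unfolding D_def by blast
  qed
  have D_mult: "g *v x \<in> D" if x: "x \<in> D" "g \<in> \<Gamma>" for x g
  proof -
    obtain b where b: "\<forall>p\<in>K. mink p x \<le> b" using x by (auto simp: D_def)
    have "mink p (g *v x) \<le> b - mink (\<tau> (matrix_inv g)) x" if "p \<in> K" for p
      using b tau_convex_aff[OF K _ that, of "matrix_inv g"] x by (simp add: mink_mult_right)
    then show ?thesis unfolding D_def by blast
  qed
  obtain p0 where "p0 \<notin> K" using K unfolding tau_convex_def by blast
  obtain p1 where p1: "p1 \<in> K" using K unfolding tau_convex_def by blast
  have "convex K" "closed K" using K unfolding tau_convex_def by blast+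
  then obtain a b where ab: "a \<bullet> p0 < b" "\<And>x. x \<in> K \<Longrightarrow> a \<bullet> x > b"
    using separating_hyperplane_closed_point[of K p0] \<open>p0 \<notin> K\<close> by metis
  define y where "y = - time_reflect a"
  have "a \<noteq> 0" using ab(1) ab(2)[OF p1] by auto
  then have "y \<noteq> 0" by (simp add: y_def)
  have yK: "mink p y \<le> - b" if "p \<in> K" for p
    using ab(2)[OF that] by (simp add: y_def mink_bilinear mink_time_reflect inner_commute)
  then have "y \<in> D" unfolding D_def by blast
  have ycausal: "norm (space_part y) \<le> y $ None"
  proof (rule causal_of_mink_chron_future_le)
    fix w :: "'d mink" assume w: "w \<in> chron_future"
    show "mink w y \<le> 0"
    proof (rule ccontr)
      assume neg: "\<not> mink w y \<le> 0"
      define s where "s = (\<bar>- b - mink p1 y\<bar> + 1) / mink w y"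
      have "s > 0" unfolding s_def using neg by (intro divide_pos_pos) auto
      then have "p1 + s *\<^sub>R w \<in> K" by (intro future_closed[OF K] p1 chron_future_scale w)
      from yK[OF this] have "s * mink w y \<le> - b - mink p1 y" by (simp add: mink_bilinear)
      moreover have "s * mink w y = \<bar>- b - mink p1 y\<bar> + 1" using neg by (simp add: s_def)
      ultimately show False by linarith
    qed
  qed
  have y0: "y $ None > 0" using causal_time_pos[OF ycausal \<open>y \<noteq> 0\<close>] .
  obtain w where w: "w \<in> D" "w \<in> chron_future"
  proof (cases "norm (space_part y) < y $ None")
    case True
    then show ?thesis using that[of y] \<open>y \<in> D\<close> by (simp add: chron_future_iff)
  next
    case False
    define y1 where "y1 = (1 / y $ None) *\<^sub>R y"
    have y1: "norm (space_part y1) = 1" "y1 $ None = 1" using False ycausal y0 by (auto simp: y1_def)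
    have "y1 \<in> D" using D_scale[OF \<open>y \<in> D\<close>] y0 by (simp add: y1_def)
    obtain g where g: "g \<in> \<Gamma>" "\<And>c. g *v y1 \<noteq> c *\<^sub>R y1" using null_direction_moved[OF y1] by blast
    define y2 where "y2 = g *v y1"
    have "y2 \<in> D" unfolding y2_def by (rule D_mult[OF \<open>y1 \<in> D\<close> g(1)])
    have y2causal: "norm (space_part y2) \<le> y2 $ None"
      unfolding y2_def using g y1 by (intro SO_plus_causal) auto
    have "mink y2 y2 = mink y1 y1" using g by (simp add: y2_def SO_plus_mink)
    then have "mink y2 y2 = 0" using y1 mink_self[of y1] by simp
    then have y2null: "norm (space_part y2) = y2 $ None" using y2causal by (rule null_norm_eq)
    have "y2 \<noteq> 0" using g(2)[of 0] by (auto simp: y2_def)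
    then have y20: "y2 $ None > 0" using causal_time_pos y2causal by blast
    have "mink y2 y1 \<noteq> 0"
      using null_parallel[OF y2null _ _ y20, of y1] y1 g(2) by (auto simp: y2_def)
    moreover have "mink y2 y1 \<le> 0"
      using norm_cauchy_schwarz[of "space_part y2" "space_part y1"] y1 y2null
      by (simp add: mink_space_part)
    ultimately have "mink (y1 + y2) (y1 + y2) < 0"
      using \<open>mink y2 y2 = 0\<close> y1 by (simp add: mink_bilinear mink_sym[of y1 y2] mink_self[of y1])
    then have "y1 + y2 \<in> chron_future" using y1 y20 by (simp add: chron_future_def)
    then show ?thesis using that D_add[OF \<open>y1 \<in> D\<close> \<open>y2 \<in> D\<close>] by blast
  qed
  have "chron_future \<subseteq> D"
    by (rule chron_future_subset_cone[OF w(2)]) (auto intro: D_add D_scale D_mult[OF w(1)])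
  then show ?thesis using v unfolding D_def by blast
qed

text \<open>Writing \<open>v\<close> as a combination \<open>\<Sum>i. a\<^sub>i g\<^sub>i v\<close> of orbit points with nonnegative coefficients,
  convexity and equivariance of the support function \<open>H\<close> give \<open>H v \<le> (\<Sum>i. a\<^sub>i) H v + c\<close>, where \<open>c\<close>
  depends only on the cocycle. By the reversed Cauchy-Schwarz inequality a nontrivial combination
  has \<open>\<Sum>i. a\<^sub>i < 1\<close>, so \<open>H v\<close> is bounded independently of the convex set.\<close>
lemma tau_convex_uniformly_bounded_above:
  assumes v: "v \<in> chron_future"
  obtains c where "\<And>K p. tau_convex \<Gamma> \<tau> K \<Longrightarrow> p \<in> K \<Longrightarrow> mink p v \<le> c"
proof -
  define q where "q = - mink v v"
  have q: "q > 0" using chron_future_mink_neg[OF v] by (simp add: q_def)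
  define dom where "dom x a c \<longleftrightarrow> 0 \<le> a \<and> a * q \<le> - mink x v \<and>
    (\<forall>K h. tau_convex \<Gamma> \<tau> K \<longrightarrow> (\<forall>p\<in>K. mink p v \<le> h) \<longrightarrow> (\<forall>p\<in>K. mink p x \<le> a * h + c))" for x a c
  \<comment> \<open>The bound \<open>H x \<le> a H v + c\<close>, where \<open>a\<close> is the sum of the coefficients in a representation of \<open>x\<close>
    by orbit points and hence satisfies \<open>a q \<le> - \<langle>x, v\<rangle>\<close>.\<close>
  define D where "D = {x. \<exists>a c. dom x a c}"
  have dom_add: "dom (x + y) (a + b) (c + d)" if "dom x a c" "dom y b d" for x y a b c d
    unfolding dom_def
  proof (intro conjI allI impI ballI)
    fix K h p assume "tau_convex \<Gamma> \<tau> K" "\<forall>p\<in>K. mink p v \<le> h" "p \<in> K"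
    then have "mink p x \<le> a * h + c" "mink p y \<le> b * h + d" using that unfolding dom_def by blast+
    then show "mink p (x + y) \<le> (a + b) * h + (c + d)" by (simp add: mink_bilinear algebra_simps)
  qed (use that in \<open>auto simp: dom_def mink_bilinear algebra_simps\<close>)
  have dom_scale: "dom (s *\<^sub>R x) (s * a) (s * c)" if "dom x a c" "s \<ge> 0" for x a c s
    unfolding dom_def
  proof (intro conjI allI impI ballI)
    fix K h p assume "tau_convex \<Gamma> \<tau> K" "\<forall>p\<in>K. mink p v \<le> h" "p \<in> K"
    then have "mink p x \<le> a * h + c" using that unfolding dom_def by blast
    then have "s * mink p x \<le> s * (a * h + c)" using that by (intro mult_left_mono)
    then show "mink p (s *\<^sub>R x) \<le> s * a * h + s * c" by (simp add: mink_bilinear algebra_simps)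
  next
    have "s * (a * q) \<le> s * (- mink x v)" using that by (intro mult_left_mono) (auto simp: dom_def)
    then show "s * a * q \<le> - mink (s *\<^sub>R x) v" by (simp add: mink_bilinear)
  qed (use that in \<open>auto simp: dom_def\<close>)
  have dom_orbit: "dom (g *v v) 1 (- mink (\<tau> (matrix_inv g)) v)" if g: "g \<in> \<Gamma>" for g
    unfolding dom_def
  proof (intro conjI allI impI ballI)
    fix K h p assume "tau_convex \<Gamma> \<tau> K" "\<forall>p\<in>K. mink p v \<le> h" "p \<in> K"
    then have "mink (aff \<tau> (matrix_inv g) p) v \<le> h" using tau_convex_aff g by blast
    then show "mink p (g *v v) \<le> 1 * h + - mink (\<tau> (matrix_inv g)) v"
      using g by (simp add: mink_mult_right)
  next
    have "mink v (g *v v) \<le> mink v v"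
      using g v by (intro mink_le_of_same_square) (auto simp: SO_plus_chron_future SO_plus_mink)
    then show "1 * q \<le> - mink (g *v v) v" by (simp add: q_def mink_sym)
  qed simp
  have cone: "chron_future \<subseteq> D"
  proof (rule chron_future_subset_cone[OF v])
    show "x + y \<in> D" if "x \<in> D" "y \<in> D" for x y
      using that dom_add unfolding D_def by blast
    show "s *\<^sub>R x \<in> D" if "x \<in> D" "s \<ge> 0" for x s
      using that dom_scale unfolding D_def by blast
    show "g *v v \<in> D" if "g \<in> \<Gamma>" for g
      using that dom_orbit unfolding D_def by blast
  qed
  define n :: "'d mink" where "n = event (axis undefined 1) 1"
  have n: "norm (space_part n) = 1" "n $ None = 1" by (auto simp: n_def)
  \<comment> \<open>An orbit point with a larger time coordinate than \<open>v\<close> is different from \<open>v\<close>.\<close>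
  define d where "d = 1 / (v $ None + 1)"
  have v0: "v $ None > 0" using v by (rule chron_future_time_pos)
  then have d: "d > 0" by (simp add: d_def)
  obtain g where g: "g \<in> \<Gamma>" "1 / d \<le> (g *v v) $ None"
    using orbit_direction[OF v n d] by metis
  have gv: "g *v v \<noteq> v" "g *v v \<in> chron_future"
    using g v0 v by (auto simp: d_def SO_plus_chron_future)
  then have "mink v (g *v v) < mink v v"
    using g v by (intro mink_less_of_same_square) (auto simp: SO_plus_mink)
  then have far: "q < - mink (g *v v) v" by (simp add: q_def mink_sym)
  obtain e where e: "e > 0" "ball v e \<subseteq> chron_future"
    using open_chron_future v open_contains_ball by blast
  define s where "s = e / (norm (g *v v) + 1)"
  have n1: "norm (g *v v) + 1 > 0" by (simp add: add_nonneg_pos)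
  then have s: "s > 0" using e by (simp add: s_def)
  have "s * (norm (g *v v) + 1) = e" using n1 by (simp add: s_def)
  then have "s * norm (g *v v) < e" using s by (simp add: algebra_simps)
  then have "v - s *\<^sub>R (g *v v) \<in> chron_future"
    using e s by (intro subsetD[OF e(2)]) (simp add: dist_norm)
  then obtain a c where ac: "dom (v - s *\<^sub>R (g *v v)) a c" using cone unfolding D_def by blast
  define c' where "c' = c + s * (- mink (\<tau> (matrix_inv g)) v)"
  have "dom (v - s *\<^sub>R (g *v v) + s *\<^sub>R (g *v v)) (a + s * 1) c'"
    unfolding c'_def using s by (intro dom_add ac dom_scale dom_orbit g) simp
  then have dv: "dom v (a + s) c'" by simp
  have "a * q \<le> q + s * mink (g *v v) v" using ac by (simp add: dom_def mink_bilinear q_def)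
  moreover have "s * (- mink (g *v v) v) > s * q" using far s by (intro mult_strict_left_mono)
  ultimately have "(a + s) * q < 1 * q" by (simp add: algebra_simps)
  then have as: "a + s < 1" using q by (simp add: mult_less_cancel_right_pos)
  have "mink p v \<le> c' / (1 - (a + s))" if K: "tau_convex \<Gamma> \<tau> K" and p: "p \<in> K" for K p
  proof -
    define h where "h = (SUP p\<in>K. mink p v)"
    have bdd: "bdd_above ((\<lambda>p. mink p v) ` K)"
      using tau_convex_bounded_above[OF K v] by (auto simp: bdd_above_def)
    have h: "mink p v \<le> h" if "p \<in> K" for p unfolding h_def by (rule cSUP_upper[OF that bdd])
    then have "\<forall>p\<in>K. mink p v \<le> (a + s) * h + c'" using dv K unfolding dom_def by blast
    then have "h \<le> (a + s) * h + c'" unfolding h_def using p by (intro cSUP_least) auto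
    then have "h * (1 - (a + s)) \<le> c'" by (simp add: algebra_simps)
    then have "h \<le> c' / (1 - (a + s))" using as by (simp add: pos_le_divide_eq)
    then show ?thesis using h[OF p] by linarith
  qed
  then show ?thesis using that by blast
qed

text \<open>The maximal set is the closed convex hull of the union of all \<open>\<tau>\<close>-convex sets; the uniform bound
  keeps it from being the whole space.\<close>
lemma max_tau_convex_greatest:
  assumes K0: "tau_convex \<Gamma> \<tau> K0"
  shows "tau_convex \<Gamma> \<tau> (max_tau_convex \<Gamma> \<tau>)"
    and "tau_convex \<Gamma> \<tau> K \<Longrightarrow> K \<subseteq> max_tau_convex \<Gamma> \<tau>"
proof -
  define U where "U = \<Union>{K. tau_convex \<Gamma> \<tau> K}"
  define M where "M = closure (convex hull U)"
  have UM: "U \<subseteq> convex hull U" "convex hull U \<subseteq> M"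
    unfolding M_def by (rule hull_subset, rule closure_subset)
  have extend: "f ` M \<subseteq> M" if f: "f ` U \<subseteq> U" "continuous_on UNIV f"
    "\<And>a b x y. a + b = 1 \<Longrightarrow> f (a *\<^sub>R x + b *\<^sub>R y) = a *\<^sub>R f x + b *\<^sub>R f y" for f
  proof -
    have "convex {x. f x \<in> convex hull U}"
      using f(3) convex_convex_hull[of U] unfolding convex_def by simp
    moreover have "U \<subseteq> {x. f x \<in> convex hull U}" using f(1) UM by blast
    ultimately have "convex hull U \<subseteq> {x. f x \<in> convex hull U}" by (rule hull_minimal[rotated])
    then have "f ` (convex hull U) \<subseteq> M" using UM by blast
    then show ?thesis unfolding M_def
      by (intro image_closure_subset continuous_on_subset[OF f(2)]) auto
  qed
  have "aff \<tau> g ` M = M" if "g \<in> \<Gamma>" for g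
  proof (rule aff_image_eqI)
    fix h X assume h: "h \<in> \<Gamma>" and X: "X \<in> M"
    have "aff \<tau> h ` U \<subseteq> U" using h tau_convex_aff unfolding U_def by blast
    from extend[OF this continuous_on_aff aff_convex_comb] show "aff \<tau> h X \<in> M" using X by blast
  qed (rule that)
  moreover have "M + chron_future \<subseteq> M"
  proof
    fix x assume "x \<in> M + chron_future"
    then obtain p w where pw: "x = p + w" "p \<in> M" "w \<in> chron_future" by (rule set_plus_elim)
    have "(\<lambda>x. x + w) ` U \<subseteq> U" using future_closed pw(3) unfolding U_def by blast
    moreover have "a *\<^sub>R x + b *\<^sub>R y + w = a *\<^sub>R (x + w) + b *\<^sub>R (y + w)" if "a + b = 1" for a b x y
      using convex_comb_cancel[OF that, of w] by (simp add: algebra_simps)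
    ultimately have "(\<lambda>x. x + w) ` M \<subseteq> M" by (intro extend continuous_intros) auto
    then show "x \<in> M" using pw by blast
  qed
  moreover have "M \<noteq> {}"
  proof -
    have "K0 \<noteq> {}" using K0 unfolding tau_convex_def by blast
    moreover have "K0 \<subseteq> U" using K0 unfolding U_def by blast
    ultimately show ?thesis using UM by blast
  qed
  moreover have "M \<noteq> UNIV"
  proof
    assume "M = UNIV"
    define v :: "'d mink" where "v = event 0 1"
    obtain c where c: "\<And>K p. tau_convex \<Gamma> \<tau> K \<Longrightarrow> p \<in> K \<Longrightarrow> mink p v \<le> c"
      using tau_convex_uniformly_bounded_above[of v] event_0_1_chron_future unfolding v_def by blast
    then have "U \<subseteq> {p. mink p v \<le> c}" unfolding U_def by blast
    then have "convex hull U \<subseteq> {p. mink p v \<le> c}" by (intro hull_minimal convex_mink_halfspace)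
    then have "M \<subseteq> {p. mink p v \<le> c}" unfolding M_def by (intro closure_minimal closed_mink_halfspace)
    then have "mink ((- c - 1) *\<^sub>R v) v \<le> c" using \<open>M = UNIV\<close> by blast
    then show False by (simp add: v_def mink_space_part)
  qed
  moreover have "closed M" "convex M" by (simp_all add: M_def convex_closure)
  ultimately have M: "tau_convex \<Gamma> \<tau> M"
    unfolding tau_convex_def by blast
  have top: "K \<subseteq> M" if "tau_convex \<Gamma> \<tau> K" for K
    using UM that unfolding U_def by blast
  have "max_tau_convex \<Gamma> \<tau> = M"
    unfolding max_tau_convex_def by (rule Greatest_equality) (rule M, erule top)
  then show "tau_convex \<Gamma> \<tau> (max_tau_convex \<Gamma> \<tau>)"
    "tau_convex \<Gamma> \<tau> K \<Longrightarrow> K \<subseteq> max_tau_convex \<Gamma> \<tau>"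
    using M top by auto
qed

end

section \<open>Volume\<close>

text \<open>By induction over elementary transformations, for which boxes suffice. That a shear has
  determinant 1 is read off as a row operation and that a transposition has determinant \<open>\<plusminus> 1\<close> from
  its being an involution, so that the index type needs no order.\<close>
lemma measure_linear_image_det:
  fixes f :: "real ^ 'n \<Rightarrow> real ^ 'n"
  assumes "linear f"
  shows "\<forall>S\<in>lmeasurable. f ` S \<in> lmeasurable \<and>
    measure lebesgue (f ` S) = \<bar>det (matrix f)\<bar> * measure lebesgue S" (is "?P f")
proof -
  have boxes: "?P h" if h: "linear h"
    "\<And>a b. cbox a b \<noteq> {} \<Longrightarrow> measure lebesgue (h ` cbox a b) = \<bar>det (matrix h)\<bar> * measure lebesgue (cbox a b)"
    for h :: "real ^ 'n \<Rightarrow> real ^ 'n"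
  proof
    fix S :: "(real ^ 'n) set" assume S: "S \<in> lmeasurable"
    have "measure lebesgue (h ` cbox a b) = \<bar>det (matrix h)\<bar> * measure lebesgue (cbox a b)" for a b
      using h(2)[of a b] by (cases "cbox a b = {}") auto
    from measure_linear_sufficient[OF h(1) S this]
    show "h ` S \<in> lmeasurable \<and> measure lebesgue (h ` S) = \<bar>det (matrix h)\<bar> * measure lebesgue S"
      by simp
  qed
  show ?thesis
  proof (rule induct_linear_elementary[OF assms])
    fix g h :: "real ^ 'n \<Rightarrow> real ^ 'n"
    assume gh: "linear g" "linear h" "?P g" "?P h"
    show "?P (g \<circ> h)"
    proof
      fix S :: "(real ^ 'n) set" assume "S \<in> lmeasurable"
      then show "(g \<circ> h) ` S \<in> lmeasurable \<and>
          measure lebesgue ((g \<circ> h) ` S) = \<bar>det (matrix (g \<circ> h))\<bar> * measure lebesgue S"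
        unfolding image_comp[symmetric] matrix_compose[OF gh(2,1)]
        using gh(3,4) by (simp add: det_mul abs_mult)
    qed
  next
    fix h :: "real ^ 'n \<Rightarrow> real ^ 'n" and i
    assume h: "linear h" "\<And>x. h x $ i = 0"
    have "\<not> surj h"
    proof
      assume "surj h"
      then obtain x where "h x = axis i 1" by (metis surjD)
      then show False using h(2)[of x] by simp
    qed
    then have sing: "\<not> inj h" using linear_injective_imp_surjective[OF h(1)] by blast
    then have "negligible (h ` S)" for S using negligible_linear_singular_image[OF h(1)] by blast
    moreover have "det (matrix h) = 0" using det_nz_iff_inj[OF h(1)] sing by blast
    ultimately show "?P h" by (simp add: negligible_iff_measure)
  next
    fix c :: "'n \<Rightarrow> real"
    have "det (matrix (\<lambda>x :: real ^ 'n. \<chi> i. c i * x $ i)) = prod c UNIV"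
      by (simp add: matrix_def axis_def det_diagonal)
    then show "?P (\<lambda>x. \<chi> i. c i * x $ i)" by (simp add: measurable_stretch measure_stretch)
  next
    fix m n :: 'n
    define h where "h x = (\<chi> i. x $ Transposition.transpose m n i)" for x :: "real ^ 'n"
    have lin: "linear h" by (rule linearI) (simp_all add: h_def vec_eq_iff)
    have hh: "h (h x) = x" for x by (simp add: h_def vec_eq_iff)
    then have "h \<circ> h = id" by auto
    then have "matrix h ** matrix h = mat 1" using matrix_compose[OF lin lin] by (simp add: matrix_id_mat_1)
    then have "det (matrix h) * det (matrix h) = 1" by (metis det_I det_mul)
    then have det: "\<bar>det (matrix h)\<bar> = 1" by (metis abs_1 abs_mult_self_eq abs_square_eq_1 power2_eq_square)
    have "?P h"
    proof (rule boxes[OF lin])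
      fix a b :: "real ^ 'n" assume ne: "cbox a b \<noteq> {}"
      have "h ` cbox a b = h -` cbox a b" using hh by (metis bij_betw_def bij_vimage_eq_inv_image involuntory_imp_bij inv_unique_comp \<open>h \<circ> h = id\<close>)
      also have "\<dots> = cbox (h a) (h b)"
        by (auto simp: h_def mem_box_cart) (metis transpose_involutory)+
      finally have eq: "h ` cbox a b = cbox (h a) (h b)" .
      then have "cbox (h a) (h b) \<noteq> {}" using ne by (metis image_is_empty)
      from content_cbox_cart[OF this]
      have "measure lebesgue (h ` cbox a b) = (\<Prod>i\<in>UNIV. (b - a) $ Transposition.transpose m n i)"
        unfolding eq by (simp add: h_def)
      also have "\<dots> = (\<Prod>i\<in>UNIV. (b - a) $ i)"
        by (rule prod.reindex_bij_betw) simp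
      also have "\<dots> = measure lebesgue (cbox a b)" using ne by (simp add: content_cbox_cart)
      finally show "measure lebesgue (h ` cbox a b) = \<bar>det (matrix h)\<bar> * measure lebesgue (cbox a b)"
        by (simp add: det)
    qed
    then show "?P (\<lambda>x. \<chi> i. x $ Transposition.transpose m n i)" by (simp add: h_def[abs_def])
  next
    fix m n :: 'n assume mn: "m \<noteq> n"
    define h where "h x = (\<chi> i. if i = m then x $ m + x $ n else x $ i)" for x :: "real ^ 'n"
    have lin: "linear h" by (rule linearI) (auto simp: h_def vec_eq_iff algebra_simps)
    have "matrix h = (\<chi> k. if k = m then row m (mat 1) + 1 *s row n (mat 1) else row k (mat 1))"
      using mn by (auto simp: matrix_def h_def row_def mat_def axis_def vec_eq_iff)
    then have det: "det (matrix h) = 1" by (simp only: det_row_operation[OF mn] det_I)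
    have "?P h"
    proof (rule boxes[OF lin])
      fix a b :: "real ^ 'n" assume ne: "cbox a b \<noteq> {}"
      define w where "w = axis n (a $ n)"
      have ab: "cbox a b = (+) w ` cbox (a - w) (b - w)" by (simp flip: cbox_translation)
      then have ne': "cbox (a - w) (b - w) \<noteq> {}" using ne by auto
      have "h ` cbox a b = (+) (h w) ` h ` cbox (a - w) (b - w)"
        by (subst ab) (simp add: image_image linear_add[OF lin])
      then have "measure lebesgue (h ` cbox a b) = measure lebesgue (h ` cbox (a - w) (b - w))"
        by (simp add: measure_translation)
      also have "\<dots> = measure lebesgue (cbox (a - w) (b - w))"
        unfolding h_def by (rule measure_shear_interval[OF mn ne']) (simp add: w_def)
      also have "\<dots> = measure lebesgue (cbox a b)" by (simp add: ab measure_translation)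
      finally show "measure lebesgue (h ` cbox a b) = \<bar>det (matrix h)\<bar> * measure lebesgue (cbox a b)"
        by (simp add: det)
    qed
    then show "?P (\<lambda>x. \<chi> i. if i = m then x $ m + x $ n else x $ i)" by (simp add: h_def[abs_def])
  qed
qed

lemma emeasure_unimodular_image:
  fixes f :: "real ^ 'n \<Rightarrow> real ^ 'n"
  assumes f: "linear f" "\<bar>det (matrix f)\<bar> = 1" and S: "S \<in> sets lebesgue"
  shows "f ` S \<in> sets lebesgue" "emeasure lebesgue (f ` S) = emeasure lebesgue S"
proof -
  define T where "T n = S \<inter> cball 0 (real n)" for n :: nat
  have T: "T n \<in> lmeasurable" for n
    unfolding T_def using fmeasurable_Int_fmeasurable[OF lmeasurable_cball S] by (metis Int_commute)
  have fT: "f ` T n \<in> lmeasurable" for n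
    using measure_linear_image_det[OF f(1)] T by blast
  have eq: "emeasure lebesgue (f ` T n) = emeasure lebesgue (T n)" for n
    using bspec[OF measure_linear_image_det[OF f(1)] T, of n] f(2) emeasure_eq_measure2[OF T, of n]
      emeasure_eq_measure2[OF fT, of n] by simp
  have "x \<in> cball 0 (real (nat \<lceil>norm x\<rceil>))" for x :: "real ^ 'n"
    by (simp add: real_nat_ceiling_ge)
  then have S_eq: "S = (\<Union>n. T n)" unfolding T_def by blast
  have inc: "incseq T" "incseq (\<lambda>n. f ` T n)"
    by (force simp: incseq_def T_def)+
  have fS: "f ` S = (\<Union>n. f ` T n)" by (subst S_eq) blast
  show "f ` S \<in> sets lebesgue" unfolding fS using fT by (intro sets.countable_UN) auto
  have "emeasure lebesgue (f ` S) = (SUP n. emeasure lebesgue (f ` T n))"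
    unfolding fS using fT inc(2) by (intro SUP_emeasure_incseq[symmetric]) auto
  also have "\<dots> = (SUP n. emeasure lebesgue (T n))" by (simp add: eq)
  also have "\<dots> = emeasure lebesgue S"
    by (subst S_eq, intro SUP_emeasure_incseq) (use T inc(1) in auto)
  finally show "emeasure lebesgue (f ` S) = emeasure lebesgue S" .
qed

text \<open>Volume is computed by integrating the lengths of the slices in direction \<open>v\<close> over a slab that
  every line in direction \<open>v\<close> crosses in unit time. Only translation invariance enters.\<close>
lemma emeasure_lborel_slices:
  fixes v e :: "'a::euclidean_space"
  assumes S: "S \<in> sets borel" and ve: "v \<bullet> e = 1"
  shows "emeasure lborel S = (\<integral>\<^sup>+X\<in>{X. 0 \<le> X \<bullet> e \<and> X \<bullet> e < 1}. emeasure lborel {s. X + s *\<^sub>R v \<in> S} \<partial>lborel)"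
proof -
  define Q where "Q = {X. 0 \<le> X \<bullet> e \<and> X \<bullet> e < 1}"
  note S [measurable]
  have Q [measurable]: "Q \<in> sets borel" unfolding Q_def by measurable
  define f :: "'a \<Rightarrow> real \<Rightarrow> ennreal" where "f X s = indicator S X * indicator Q (X - s *\<^sub>R v)" for X s
  have one: "(\<integral>\<^sup>+s. indicator Q (X - s *\<^sub>R v) \<partial>lborel) = 1" for X
  proof -
    have "indicator Q (X - s *\<^sub>R v) = (indicator {X \<bullet> e - 1<..X \<bullet> e} s :: ennreal)" for s
      using ve by (auto simp: Q_def inner_diff_left indicator_def)
    then show ?thesis by simp
  qed
  have "emeasure lborel S = (\<integral>\<^sup>+X. indicator S X \<partial>lborel)" using S by simp
  also have "\<dots> = (\<integral>\<^sup>+X. \<integral>\<^sup>+s. f X s \<partial>lborel \<partial>lborel)"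
    unfolding f_def using Q by (subst nn_integral_cmult) (auto simp: one)
  also have "\<dots> = (\<integral>\<^sup>+s. \<integral>\<^sup>+X. f X s \<partial>lborel \<partial>lborel)"
    unfolding f_def by (intro lborel_pair.Fubini'[symmetric]) measurable
  also have "\<dots> = (\<integral>\<^sup>+s. \<integral>\<^sup>+X. indicator S (X + s *\<^sub>R v) * indicator Q X \<partial>lborel \<partial>lborel)"
  proof (rule nn_integral_cong)
    fix s
    have "(\<integral>\<^sup>+X. f X s \<partial>lborel) = (\<integral>\<^sup>+X. f X s \<partial>distr lborel borel ((+) (s *\<^sub>R v)))"
      by (simp add: lborel_distr_plus)
    also have "\<dots> = (\<integral>\<^sup>+X. f (s *\<^sub>R v + X) s \<partial>lborel)"
      unfolding f_def by (intro nn_integral_distr) measurable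
    finally show "(\<integral>\<^sup>+X. f X s \<partial>lborel) = (\<integral>\<^sup>+X. indicator S (X + s *\<^sub>R v) * indicator Q X \<partial>lborel)"
      by (simp add: f_def add.commute)
  qed
  also have "\<dots> = (\<integral>\<^sup>+X. \<integral>\<^sup>+s. indicator S (X + s *\<^sub>R v) * indicator Q X \<partial>lborel \<partial>lborel)"
    by (intro lborel_pair.Fubini') measurable
  also have "\<dots> = (\<integral>\<^sup>+X. emeasure lborel {s. X + s *\<^sub>R v \<in> S} * indicator Q X \<partial>lborel)"
  proof (rule nn_integral_cong)
    fix X
    have "{s. X + s *\<^sub>R v \<in> S} = (\<lambda>s. X + s *\<^sub>R v) -` S \<inter> space borel" by auto
    moreover have "(\<lambda>s. X + s *\<^sub>R v) \<in> borel_measurable borel" by measurable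
    ultimately have m: "{s. X + s *\<^sub>R v \<in> S} \<in> sets borel" using S by (metis measurable_sets)
    have "(\<integral>\<^sup>+s. indicator S (X + s *\<^sub>R v) * indicator Q X \<partial>lborel)
        = (\<integral>\<^sup>+s. indicator {s. X + s *\<^sub>R v \<in> S} s * indicator Q X \<partial>lborel)"
      by (intro nn_integral_cong) (simp add: indicator_def)
    also have "\<dots> = emeasure lborel {s. X + s *\<^sub>R v \<in> S} * indicator Q X"
      using m by (subst nn_integral_multc) auto
    finally show "(\<integral>\<^sup>+s. indicator S (X + s *\<^sub>R v) * indicator Q X \<partial>lborel)
        = emeasure lborel {s. X + s *\<^sub>R v \<in> S} * indicator Q X" .
  qed
  finally show ?thesis unfolding Q_def .
qed

lemma measurable_slice_length:
  fixes v :: "'a::euclidean_space"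
  assumes [measurable]: "S \<in> sets borel"
  shows "(\<lambda>X. emeasure lborel {s. X + s *\<^sub>R v \<in> S}) \<in> borel_measurable borel"
proof -
  define W where "W = {p \<in> space (borel \<Otimes>\<^sub>M lborel). fst p + snd p *\<^sub>R v \<in> S}"
  have "W \<in> sets (borel \<Otimes>\<^sub>M lborel)" unfolding W_def by measurable
  from lborel.measurable_emeasure_Pair[OF this]
  show ?thesis by (simp add: W_def space_pair_measure)
qed

text \<open>Let \<open>e\<close>, \<open>k\<^sub>0\<close>, \<open>k\<^sub>1\<close> be the infima of \<open>U\<close>, \<open>A0\<close>, \<open>A1\<close>. Then \<open>U - A\<close> is contained in the interval from
  \<open>e\<close> to \<open>(1 - t) k\<^sub>0 + t k\<^sub>1\<close>, while \<open>U - A0\<close> and \<open>U - A1\<close> contain the open intervals from \<open>e\<close> to \<open>k\<^sub>0\<close> and to \<open>k\<^sub>1\<close>;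
  and \<open>max 0 (k - e)\<close> is a convex function of \<open>k\<close>.\<close>
lemma half_line_difference_convex:
  fixes U A0 A1 A :: "real set"
  assumes t: "0 \<le> t" "t \<le> 1"
    and U: "\<And>s r. s \<in> U \<Longrightarrow> s \<le> r \<Longrightarrow> r \<in> U" "bdd_below U" "U \<in> sets borel"
    and A0: "A0 \<noteq> {}" "bdd_below A0" "A0 \<in> sets borel"
    and A1: "A1 \<noteq> {}" "bdd_below A1" "A1 \<in> sets borel"
    and A: "\<And>a0 a1 s. a0 \<in> A0 \<Longrightarrow> a1 \<in> A1 \<Longrightarrow> (1 - t) * a0 + t * a1 < s \<Longrightarrow> s \<in> A"
  shows "emeasure lborel (U - A)
    \<le> ennreal (1 - t) * emeasure lborel (U - A0) + ennreal t * emeasure lborel (U - A1)"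
proof (cases "U = {}")
  case False
  define e where "e = Inf U"
  define k0 where "k0 = Inf A0"
  define k1 where "k1 = Inf A1"
  define m where "m = (1 - t) * k0 + t * k1"
  have lower: "ennreal (Inf B - e) \<le> emeasure lborel (U - B)"
    if B: "B \<noteq> {}" "bdd_below B" "B \<in> sets borel" for B
  proof -
    have "{e<..<Inf B} \<subseteq> U - B"
    proof
      fix s assume s: "s \<in> {e<..<Inf B}"
      then obtain r where "r \<in> U" "r < s" using cInf_lessD[OF False, of s] by (auto simp: e_def)
      then have "s \<in> U" using U(1)[of r s] by simp
      moreover have "s \<notin> B" using s B(2) cInf_lower[of s B] by fastforce
      ultimately show "s \<in> U - B" by blast
    qed
    then have "emeasure lborel {e<..<Inf B} \<le> emeasure lborel (U - B)"
      using U B by (intro emeasure_mono) auto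
    then show ?thesis by (cases "e \<le> Inf B") (auto simp: ennreal_neg)
  qed
  have "U - A \<subseteq> {e..m}"
  proof
    fix s assume s: "s \<in> U - A"
    then have "e \<le> s" unfolding e_def using U(2) by (auto intro: cInf_lower)
    moreover have "s \<le> m"
    proof (rule ccontr)
      assume "\<not> s \<le> m"
      define d where "d = s - m"
      have d: "d > 0" using \<open>\<not> s \<le> m\<close> by (simp add: d_def)
      obtain a0 where a0: "a0 \<in> A0" "a0 < k0 + d" using cInf_lessD[OF A0(1), of "k0 + d"] d by (auto simp: k0_def)
      obtain a1 where a1: "a1 \<in> A1" "a1 < k1 + d" using cInf_lessD[OF A1(1), of "k1 + d"] d by (auto simp: k1_def)
      have "(1 - t) * a0 + t * a1 < (1 - t) * (k0 + d) + t * (k1 + d)"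
      proof (cases "t = 0")
        case False
        then show ?thesis
          using a0 a1 t by (intro add_le_less_mono mult_left_mono mult_strict_left_mono) auto
      qed (use a0 in simp)
      also have "\<dots> = s" by (simp add: d_def m_def algebra_simps)
      finally have "s \<in> A" by (rule A[OF a0(1) a1(1)])
      then show False using s by blast
    qed
    ultimately show "s \<in> {e..m}" by simp
  qed
  then have "emeasure lborel (U - A) \<le> emeasure lborel {e..m}" by (intro emeasure_mono) auto
  also have "\<dots> \<le> ennreal (m - e)" by (cases "e \<le> m") auto
  also have "\<dots> \<le> ennreal ((1 - t) * max 0 (k0 - e) + t * max 0 (k1 - e))"
  proof (rule ennreal_leI)
    have "m - e = (1 - t) * (k0 - e) + t * (k1 - e)" by (simp add: m_def algebra_simps)
    also have "\<dots> \<le> (1 - t) * max 0 (k0 - e) + t * max 0 (k1 - e)"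
      using t by (intro add_mono mult_left_mono) auto
    finally show "m - e \<le> (1 - t) * max 0 (k0 - e) + t * max 0 (k1 - e)" .
  qed
  also have "\<dots> = ennreal (1 - t) * ennreal (k0 - e) + ennreal t * ennreal (k1 - e)"
    using t by (simp add: ennreal_plus ennreal_mult ennreal_max_0)
  also have "\<dots> \<le> ennreal (1 - t) * emeasure lborel (U - A0) + ennreal t * emeasure lborel (U - A1)"
    unfolding k0_def k1_def by (intro add_mono mult_left_mono lower A0 A1) auto
  finally show ?thesis .
qed simp

context affine_lattice
begin

lemma emeasure_aff_image:
  assumes g: "g \<in> \<Gamma>" and S: "S \<in> sets lebesgue"
  shows "aff \<tau> g ` S \<in> sets lebesgue" "emeasure lebesgue (aff \<tau> g ` S) = emeasure lebesgue S"
proof -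
  have lin: "linear ((*v) g)" by simp
  have det: "\<bar>det (matrix ((*v) g))\<bar> = 1" using SO_plus_det[of g] g by simp
  define T where "T = (*v) g ` S"
  have T: "T \<in> sets lebesgue" "emeasure lebesgue T = emeasure lebesgue S"
    unfolding T_def using emeasure_unimodular_image[OF lin det S] by auto
  have eq: "aff \<tau> g ` S = (+) (\<tau> g) ` T" by (auto simp: T_def aff_def image_image add.commute)
  show "aff \<tau> g ` S \<in> sets lebesgue" unfolding eq using T by (simp add: lebesgue_sets_translation)
  show "emeasure lebesgue (aff \<tau> g ` S) = emeasure lebesgue S"
    unfolding eq using T emeasure_lebesgue_affine[of 1 "\<tau> g" T] by (simp add: add.commute)
qed

text \<open>Cut \<open>F\<close> by the translates of \<open>F'\<close> and move the pieces back: they become almost disjoint subsets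
  of \<open>F'\<close>. The countable sums are written as integrals over the counting measure on \<open>\<Gamma>\<close>.\<close>
lemma fundamental_domain_le:
  assumes F: "fundamental_domain \<Gamma> \<tau> F" and F': "fundamental_domain \<Gamma> \<tau> F'"
    and A: "A \<in> sets lebesgue" "\<And>g. g \<in> \<Gamma> \<Longrightarrow> aff \<tau> g ` A = A"
  shows "emeasure lebesgue (A \<inter> F) \<le> emeasure lebesgue (A \<inter> F')"
proof -
  have m: "F \<in> sets lebesgue" "F' \<in> sets lebesgue"
    using F F' unfolding fundamental_domain_def by blast+
  have null: "aff \<tau> g ` F \<inter> aff \<tau> h ` F \<in> null_sets lebesgue" if gh: "g \<in> \<Gamma>" "h \<in> \<Gamma>" "g \<noteq> h" for g h
  proof -
    define k where "k = matrix_inv h ** g"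
    have k: "k \<in> \<Gamma>" using gh by (simp add: k_def)
    have hk: "h ** k = g" using gh by (simp add: k_def matrix_mul_assoc matrix_inv_SO_plus)
    then have "k \<noteq> mat 1" using gh by auto
    then have kF: "aff \<tau> k ` F \<inter> F \<in> null_sets lebesgue" using F k by (simp add: fundamental_domain_def)
    have "inj (aff \<tau> h)" using aff_inv(1)[OF gh(2)] by (metis injI)
    then have "aff \<tau> h ` (aff \<tau> k ` F \<inter> F) = aff \<tau> h ` aff \<tau> k ` F \<inter> aff \<tau> h ` F"
      by (rule image_Int)
    also have "aff \<tau> h ` aff \<tau> k ` F = aff \<tau> g ` F"
      using aff_mult[OF gh(2) k] by (simp add: image_image hk)
    finally show ?thesis
      using emeasure_aff_image[OF gh(2), of "aff \<tau> k ` F \<inter> F"] kF by (auto simp: null_sets_def)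
  qed
  have inv_img: "aff \<tau> (matrix_inv g) ` (A \<inter> F \<inter> aff \<tau> g ` F') = A \<inter> aff \<tau> (matrix_inv g) ` F \<inter> F'"
    if g: "g \<in> \<Gamma>" for g
  proof -
    have "inj (aff \<tau> (matrix_inv g))" using aff_inv(2)[OF g] by (metis injI)
    then show ?thesis using g A(2)[of "matrix_inv g"] by (simp add: image_Int image_image)
  qed
  have "emeasure lebesgue (A \<inter> F) = (\<integral>\<^sup>+X. indicator (A \<inter> F) X \<partial>lebesgue)" using m A by simp
  also have "\<dots> \<le> (\<integral>\<^sup>+X. \<integral>\<^sup>+g. indicator (A \<inter> F \<inter> aff \<tau> g ` F') X \<partial>count_space \<Gamma> \<partial>lebesgue)"
  proof (rule nn_integral_mono_AE)
    have "AE X in lebesgue. X \<in> interior (max_tau_convex \<Gamma> \<tau>) \<longrightarrow> (\<exists>g\<in>\<Gamma>. X \<in> aff \<tau> g ` F')"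
      using F' by (simp add: fundamental_domain_def)
    then show "AE X in lebesgue. indicator (A \<inter> F) X
        \<le> (\<integral>\<^sup>+g. indicator (A \<inter> F \<inter> aff \<tau> g ` F') X \<partial>count_space \<Gamma>)"
    proof eventually_elim
      case (elim X)
      show ?case
      proof (cases "X \<in> A \<inter> F")
        case True
        then have "X \<in> interior (max_tau_convex \<Gamma> \<tau>)" using F by (auto simp: fundamental_domain_def)
        then obtain g where g: "g \<in> \<Gamma>" "X \<in> aff \<tau> g ` F'" using elim by blast
        have "1 = (\<integral>\<^sup>+h. indicator {g} h \<partial>count_space \<Gamma>)" using g by simp
        also have "\<dots> \<le> (\<integral>\<^sup>+h. indicator (A \<inter> F \<inter> aff \<tau> h ` F') X \<partial>count_space \<Gamma>)"
          using g True by (intro nn_integral_mono) (auto simp: indicator_def)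
        finally show ?thesis using True by simp
      qed simp
    qed
  qed
  also have "\<dots> = (\<integral>\<^sup>+g. \<integral>\<^sup>+X. indicator (A \<inter> F \<inter> aff \<tau> g ` F') X \<partial>lebesgue \<partial>count_space \<Gamma>)"
    using m A by (intro nn_integral_count_space_nn_integral countable_\<Gamma>)
      (auto intro!: borel_measurable_indicator sets.Int emeasure_aff_image)
  also have "\<dots> = (\<integral>\<^sup>+g. \<integral>\<^sup>+X. indicator (A \<inter> aff \<tau> (matrix_inv g) ` F \<inter> F') X \<partial>lebesgue \<partial>count_space \<Gamma>)"
  proof (rule nn_integral_cong)
    fix g assume "g \<in> space (count_space \<Gamma>)"
    then have g: "g \<in> \<Gamma>" by simp
    have s: "A \<inter> F \<inter> aff \<tau> g ` F' \<in> sets lebesgue" "A \<inter> aff \<tau> (matrix_inv g) ` F \<inter> F' \<in> sets lebesgue"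
      using m A g by (auto intro!: sets.Int emeasure_aff_image)
    then show "(\<integral>\<^sup>+X. indicator (A \<inter> F \<inter> aff \<tau> g ` F') X \<partial>lebesgue)
        = (\<integral>\<^sup>+X. indicator (A \<inter> aff \<tau> (matrix_inv g) ` F \<inter> F') X \<partial>lebesgue)"
      using emeasure_aff_image(2)[of "matrix_inv g", OF _ s(1)] g by (simp add: inv_img)
  qed
  also have "\<dots> = (\<integral>\<^sup>+X. \<integral>\<^sup>+g. indicator (A \<inter> aff \<tau> (matrix_inv g) ` F \<inter> F') X \<partial>count_space \<Gamma> \<partial>lebesgue)"
    using m A by (intro nn_integral_count_space_nn_integral[symmetric] countable_\<Gamma>)
      (auto intro!: borel_measurable_indicator sets.Int emeasure_aff_image)
  also have "\<dots> \<le> (\<integral>\<^sup>+X. indicator (A \<inter> F') X \<partial>lebesgue)"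
  proof (rule nn_integral_mono_AE)
    have "AE X in lebesgue. \<forall>g\<in>\<Gamma>. \<forall>h\<in>\<Gamma>. g \<noteq> h \<longrightarrow> X \<notin> aff \<tau> g ` F \<inter> aff \<tau> h ` F"
    proof -
      have "AE X in lebesgue. g \<noteq> h \<longrightarrow> X \<notin> aff \<tau> g ` F \<inter> aff \<tau> h ` F"
        if "g \<in> \<Gamma>" "h \<in> \<Gamma>" for g h
        using AE_not_in[OF null[OF that]] by (cases "g = h") simp_all
      then show ?thesis by (simp add: AE_ball_countable countable_\<Gamma> del: Int_iff)
    qed
    then show "AE X in lebesgue. (\<integral>\<^sup>+g. indicator (A \<inter> aff \<tau> (matrix_inv g) ` F \<inter> F') X \<partial>count_space \<Gamma>)
        \<le> indicator (A \<inter> F') X"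
    proof eventually_elim
      case (elim X)
      show ?case
      proof (cases "X \<in> A \<inter> F' \<and> (\<exists>g\<in>\<Gamma>. X \<in> aff \<tau> (matrix_inv g) ` F)")
        case True
        then obtain g where g: "g \<in> \<Gamma>" "X \<in> aff \<tau> (matrix_inv g) ` F" by blast
        have "h = g" if "h \<in> \<Gamma>" "X \<in> aff \<tau> (matrix_inv h) ` F" for h
          using elim that g matrix_inv_inv inv_\<Gamma> by (metis IntI)
        then have "(\<integral>\<^sup>+h. indicator (A \<inter> aff \<tau> (matrix_inv h) ` F \<inter> F') X \<partial>count_space \<Gamma>)
            \<le> (\<integral>\<^sup>+h. indicator {g} h \<partial>count_space \<Gamma>)"
          by (intro nn_integral_mono) (auto simp: indicator_def)
        also have "\<dots> = 1" using g by simp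
        finally show ?thesis using True by simp
      next
        case False
        then have "(\<integral>\<^sup>+h. indicator (A \<inter> aff \<tau> (matrix_inv h) ` F \<inter> F') X \<partial>count_space \<Gamma>)
            = (\<integral>\<^sup>+h. 0 \<partial>count_space \<Gamma>)"
          by (intro nn_integral_cong) (auto simp: indicator_def)
        then show ?thesis by simp
      qed
    qed
  qed
  also have "\<dots> = emeasure lebesgue (A \<inter> F')" using m A by simp
  finally show ?thesis .
qed

end

section \<open>The Dirichlet domain of a timelike direction\<close>

lemma timelike_line_meets_future:
  assumes v: "v \<in> chron_future" and K: "tau_convex \<Gamma> \<tau> K"
  shows "\<exists>s. X + s *\<^sub>R v \<in> K"
proof -
  obtain p where p: "p \<in> K" using K unfolding tau_convex_def by blast
  define c where "c = v $ None - norm (space_part v)"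
  have c: "c > 0" using v by (simp add: c_def chron_future_iff)
  define s where "s = (2 * norm (X - p) + 1) / c"
  have s: "s \<ge> 0" "s * c = 2 * norm (X - p) + 1" using c by (auto simp: s_def)
  define w where "w = X - p"
  have "norm (space_part (w + s *\<^sub>R v)) \<le> norm w + s * norm (space_part v)"
    using norm_triangle_ineq[of "space_part w" "s *\<^sub>R space_part v"] norm_space_part_le[of w] s by simp
  also have "\<dots> < - norm w + s * v $ None"
    using s(2) by (simp add: c_def w_def algebra_simps)
  also have "\<dots> \<le> (w + s *\<^sub>R v) $ None"
    using component_le_norm_cart[of w None] by simp
  finally have "w + s *\<^sub>R v \<in> chron_future" by (simp add: chron_future_iff)
  then have "p + (w + s *\<^sub>R v) \<in> K" by (rule future_closed[OF K p])
  then show ?thesis by (auto simp: w_def)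
qed

context affine_lattice
begin

text \<open>The vectors fixed by some nontrivial element of the countable group form a null set.\<close>
lemma exists_free_timelike:
  obtains v where "v \<in> chron_future" "\<And>g. g \<in> \<Gamma> \<Longrightarrow> g *v v = v \<Longrightarrow> g = mat 1"
proof -
  define N where "N = (\<Union>g\<in>\<Gamma> - {mat 1}. {x. g *v x = x})"
  have "negligible {x. g *v x = x}" if g: "g \<in> \<Gamma> - {mat 1}" for g
  proof -
    have "g - mat 1 \<noteq> 0" using g by simp
    then obtain i where i: "(g - mat 1) $ i \<noteq> 0" by (metis vec_eq_iff zero_index)
    have "(g - mat 1) $ i \<bullet> x = 0" if "g *v x = x" for x
    proof -
      have "(g - mat 1) *v x = 0" using that by (simp add: matrix_vector_mult_diff_rdistrib)
      then show ?thesis by (metis matrix_vector_mul_component zero_index)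
    qed
    then have "{x. g *v x = x} \<subseteq> {x. (g - mat 1) $ i \<bullet> x = 0}" by blast
    then show ?thesis using negligible_hyperplane[of "(g - mat 1) $ i" 0] i negligible_subset by blast
  qed
  then have "negligible N"
    unfolding N_def using countable_\<Gamma> by (intro negligible_countable_Union) auto
  moreover have "\<not> negligible (chron_future :: 'd mink set)"
    using open_not_negligible[OF open_chron_future] event_0_1_chron_future by blast
  ultimately obtain v where "v \<in> chron_future" "v \<notin> N"
    using negligible_subset by (metis subsetI)
  then show ?thesis using that unfolding N_def by blast
qed

lemma aff_image_Diff:
  assumes "\<And>g. g \<in> \<Gamma> \<Longrightarrow> aff \<tau> g ` S = S" "\<And>g. g \<in> \<Gamma> \<Longrightarrow> aff \<tau> g ` T = T" "g \<in> \<Gamma>"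
  shows "aff \<tau> g ` (S - T) = S - T"
proof -
  have "inj (aff \<tau> g)" using aff_inv(1)[OF assms(3)] by (metis injI)
  then show ?thesis using assms by (simp add: image_set_diff)
qed

lemma aff_image_interior:
  assumes S: "\<And>g. g \<in> \<Gamma> \<Longrightarrow> aff \<tau> g ` S = S" and "g \<in> \<Gamma>"
  shows "aff \<tau> g ` interior S = interior S"
proof (rule aff_image_eqI)
  fix h X assume h: "h \<in> \<Gamma>" and X: "X \<in> interior S"
  define W where "W = aff \<tau> (matrix_inv h) -` interior S"
  have "open W" unfolding W_def using continuous_on_aff by (intro open_vimage) auto
  moreover have "W \<subseteq> S"
  proof
    fix Y assume "Y \<in> W"
    then have "aff \<tau> (matrix_inv h) Y \<in> S" using interior_subset by (auto simp: W_def)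
    then have "aff \<tau> h (aff \<tau> (matrix_inv h) Y) \<in> S" using S[OF h] by blast
    then show "Y \<in> S" using h by simp
  qed
  moreover have "aff \<tau> h X \<in> W" using h X by (simp add: W_def)
  ultimately show "aff \<tau> h X \<in> interior S" by (meson interior_maximal subsetD)
qed (rule assms)

end

locale timelike_direction = affine_lattice \<Gamma> \<tau>
  for \<Gamma> :: "'d::finite mink_mat set" and \<tau> :: "'d mink_mat \<Rightarrow> 'd mink" +
  fixes \<Omega> :: "'d mink set" and v :: "'d mink"
  assumes max: "\<Omega> = max_tau_convex \<Gamma> \<tau>" and \<Omega>: "tau_convex \<Gamma> \<tau> \<Omega>"
    and v: "v \<in> chron_future" and free: "\<And>g. g \<in> \<Gamma> \<Longrightarrow> g *v v = v \<Longrightarrow> g = mat 1"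
begin

text \<open>A Dirichlet domain, with the linear function \<open>\<langle>\<cdot>, v\<rangle>\<close>, called height below, in the part of the
  distance from a base point: instead of the nearest points of an orbit the highest are selected.\<close>
definition dirichlet :: "'d mink set" where
  "dirichlet = {X \<in> interior \<Omega>. \<forall>g\<in>\<Gamma>. mink (aff \<tau> g X) v \<le> mink X v}"

lemma \<Omega>_aff: "g \<in> \<Gamma> \<Longrightarrow> aff \<tau> g ` \<Omega> = \<Omega>"
  using \<Omega> unfolding tau_convex_def by blast

lemma dirichlet_borel: "dirichlet \<in> sets borel"
proof -
  have "closed {X. mink (aff \<tau> g X) v \<le> mink X v}" for g
    by (intro closed_Collect_le continuous_intros continuous_on_aff)
  then have "closed (\<Inter>g\<in>\<Gamma>. {X. mink (aff \<tau> g X) v \<le> mink X v})" by blast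
  moreover have "dirichlet = interior \<Omega> \<inter> (\<Inter>g\<in>\<Gamma>. {X. mink (aff \<tau> g X) v \<le> mink X v})"
    by (auto simp: dirichlet_def)
  ultimately show ?thesis by (simp add: borel_closed borel_open sets.Int)
qed

text \<open>A ball of radius \<open>r\<close> about \<open>X\<close> contained in \<open>\<Omega>\<close> is mapped by \<open>g\<close> into \<open>\<Omega>\<close>, on which the height
  is bounded. As the image reaches \<open>r |g\<^sup>-\<^sup>1 v|\<close> higher than \<open>g X\<close>, only finitely many points of the
  orbit are at least as high as \<open>X\<close>.\<close>
lemma finite_higher:
  assumes X: "X \<in> interior \<Omega>"
  shows "finite {g \<in> \<Gamma>. mink X v \<le> mink (aff \<tau> g X) v}"
proof -
  obtain h where h: "\<And>p. p \<in> \<Omega> \<Longrightarrow> mink p v \<le> h"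
    using tau_convex_bounded_above[OF \<Omega> v] by blast
  obtain r where r: "r > 0" "cball X r \<subseteq> \<Omega>" using X by (metis mem_interior_cball)
  define B where "B = (h - mink X v) / r"
  have "norm (matrix_inv g *v v) \<le> B" if g: "g \<in> \<Gamma>" "mink X v \<le> mink (aff \<tau> g X) v" for g
  proof -
    define w where "w = matrix_inv g *v v"
    define u where "u = r *\<^sub>R sgn (time_reflect w)"
    have "X + u \<in> cball X r" using r by (simp add: u_def dist_norm norm_sgn)
    then have "X + u \<in> \<Omega>" using r by blast
    then have "aff \<tau> g (X + u) \<in> \<Omega>" using \<Omega>_aff g by blast
    then have "mink (aff \<tau> g (X + u)) v \<le> h" by (rule h)
    moreover have "aff \<tau> g (X + u) = aff \<tau> g X + g *v u"
      by (simp add: aff_def matrix_vector_right_distrib)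
    moreover have "mink (g *v u) v = r * norm w"
    proof -
      have "mink (g *v u) v = u \<bullet> time_reflect w"
        using mink_matrix_inv[of g v u] g by (simp add: w_def mink_inner[symmetric] mink_sym)
      also have "\<dots> = r * norm (time_reflect w)"
        by (cases "time_reflect w = 0") (simp_all add: u_def sgn_div_norm dot_square_norm power2_eq_square)
      finally show ?thesis by simp
    qed
    ultimately have "r * norm w \<le> h - mink X v" using g by (simp add: mink_bilinear)
    then show ?thesis using r by (simp add: B_def w_def pos_le_divide_eq mult.commute)
  qed
  then have "{g \<in> \<Gamma>. mink X v \<le> mink (aff \<tau> g X) v} \<subseteq> matrix_inv ` {g \<in> \<Gamma>. norm (g *v v) \<le> B}"
    using matrix_inv_inv by (force intro: image_eqI[of _ _ "matrix_inv _"])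
  then show ?thesis using finite_bounded_orbit[OF v] finite_subset by blast
qed

text \<open>A point common to the domain and its translate by \<open>g\<close> has the same height as its preimage under \<open>g\<close>.
  This is a nontrivial affine condition because \<open>g v \<noteq> v\<close>.\<close>
lemma fundamental_domain_dirichlet: "fundamental_domain \<Gamma> \<tau> dirichlet"
  unfolding fundamental_domain_def max[symmetric]
proof (intro conjI ballI impI)
  show "dirichlet \<in> sets lebesgue" using dirichlet_borel by simp
  show "dirichlet \<subseteq> interior \<Omega>" by (auto simp: dirichlet_def)
next
  have "\<exists>g\<in>\<Gamma>. X \<in> aff \<tau> g ` dirichlet" if X: "X \<in> interior \<Omega>" for X
  proof -
    define S where "S = {g \<in> \<Gamma>. mink X v \<le> mink (aff \<tau> g X) v}"
    define f where "f g = mink (aff \<tau> g X) v" for g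
    have S: "finite S" "mat 1 \<in> S" using finite_higher[OF X] by (auto simp: S_def)
    then have "Max (f ` S) \<in> f ` S" by (intro Max_in) auto
    then obtain g where g: "g \<in> S" "\<And>h. h \<in> S \<Longrightarrow> f h \<le> f g" using S by (metis Max_ge finite_imageI imageE imageI)
    have g\<Gamma>: "g \<in> \<Gamma>" using g by (simp add: S_def)
    have all: "f h \<le> f g" if "h \<in> \<Gamma>" for h
    proof (cases "h \<in> S")
      case False
      then have "f h < mink X v" using that by (auto simp: S_def f_def)
      also have "\<dots> = f (mat 1)" by (simp add: f_def)
      also have "\<dots> \<le> f g" using g S by blast
      finally show ?thesis by simp
    qed (use g in blast)
    have "mink (aff \<tau> h (aff \<tau> g X)) v \<le> mink (aff \<tau> g X) v" if h: "h \<in> \<Gamma>" for h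
      using all[of "h ** g"] h g\<Gamma> by (simp add: f_def aff_mult)
    moreover have "aff \<tau> g X \<in> interior \<Omega>" using aff_image_interior[OF \<Omega>_aff g\<Gamma>] X by blast
    ultimately have "aff \<tau> g X \<in> dirichlet" by (simp add: dirichlet_def)
    then have "X \<in> aff \<tau> (matrix_inv g) ` dirichlet"
      using g\<Gamma> by (intro image_eqI[of X _ "aff \<tau> g X"]) auto
    then show ?thesis using g\<Gamma> by blast
  qed
  then show "AE X in lebesgue. X \<in> interior \<Omega> \<longrightarrow> (\<exists>g\<in>\<Gamma>. X \<in> aff \<tau> g ` dirichlet)" by simp
next
  fix g assume g: "g \<in> \<Gamma>" "g \<noteq> mat 1"
  define w where "w = time_reflect (v - g *v v)"
  define c where "c = mink (\<tau> (matrix_inv g)) v"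
  have "w \<noteq> 0" using free[OF g(1)] g by (auto simp: w_def)
  have "X \<bullet> w = c" if X: "X \<in> aff \<tau> g ` dirichlet \<inter> dirichlet" for X
  proof -
    have Y: "aff \<tau> (matrix_inv g) X \<in> dirichlet" "X \<in> dirichlet" using X g by (auto simp: mem_aff_image)
    have "mink (aff \<tau> g (aff \<tau> (matrix_inv g) X)) v \<le> mink (aff \<tau> (matrix_inv g) X) v"
      using Y(1) g(1) unfolding dirichlet_def by blast
    moreover have "mink (aff \<tau> (matrix_inv g) X) v \<le> mink X v"
      using Y(2) g by (simp add: dirichlet_def)
    ultimately have "mink X v = mink (aff \<tau> (matrix_inv g) X) v" using g by simp
    also have "\<dots> = mink X (g *v v) + c" using mink_mult_right[OF g(1), of X v] by (simp add: c_def)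
    finally show ?thesis by (simp add: w_def mink_inner[symmetric] mink_bilinear)
  qed
  then have "aff \<tau> g ` dirichlet \<inter> dirichlet \<subseteq> {X. w \<bullet> X = c}" by (auto simp: inner_commute)
  moreover have "negligible {X. w \<bullet> X = c}" using \<open>w \<noteq> 0\<close> by (intro negligible_hyperplane) simp
  ultimately show "aff \<tau> g ` dirichlet \<inter> dirichlet \<in> null_sets lebesgue"
    using negligible_subset negligible_iff_null_sets by blast
qed

text \<open>Translation by \<open>s v\<close> raises the height of \<open>g X\<close> by \<open>s \<langle>g v, v\<rangle>\<close>, which by the reversed
  Cauchy-Schwarz inequality is at most the amount \<open>s \<langle>v, v\<rangle>\<close> by which it raises that of \<open>X\<close>.\<close>
lemma dirichlet_future:
  assumes X: "X \<in> dirichlet" and s: "s \<ge> 0"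
  shows "X + s *\<^sub>R v \<in> dirichlet"
proof (cases "s = 0")
  case False
  then have sv: "s *\<^sub>R v \<in> chron_future" using s v by (intro chron_future_scale) auto
  have "(\<lambda>x. s *\<^sub>R v + x) ` interior \<Omega> \<subseteq> \<Omega>"
    using future_closed[OF \<Omega> _ sv] interior_subset by (force simp: add.commute)
  then have "(\<lambda>x. s *\<^sub>R v + x) ` interior \<Omega> \<subseteq> interior \<Omega>"
    by (intro interior_maximal open_translation open_interior)
  then have "X + s *\<^sub>R v \<in> interior \<Omega>" using X by (force simp: dirichlet_def add.commute)
  moreover have "mink (aff \<tau> g (X + s *\<^sub>R v)) v \<le> mink (X + s *\<^sub>R v) v" if g: "g \<in> \<Gamma>" for g
  proof -
    have "mink v (g *v v) \<le> mink v v"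
      using g v by (intro mink_le_of_same_square) (auto simp: SO_plus_chron_future SO_plus_mink)
    then have "s * mink (g *v v) v \<le> s * mink v v" using s by (simp add: mink_sym mult_left_mono)
    moreover have "aff \<tau> g (X + s *\<^sub>R v) = aff \<tau> g X + s *\<^sub>R (g *v v)"
      by (simp add: aff_def matrix_vector_right_distrib matrix_vector_mult_scaleR)
    moreover have "mink (aff \<tau> g X) v \<le> mink X v" using X g by (simp add: dirichlet_def)
    ultimately show ?thesis by (simp add: mink_bilinear)
  qed
  ultimately show ?thesis by (simp add: dirichlet_def)
qed (use X in simp)

lemma covol_dirichlet:
  assumes K: "K \<in> sets borel" "\<And>g. g \<in> \<Gamma> \<Longrightarrow> aff \<tau> g ` K = K"
  shows "emeasure lebesgue ((\<Omega> - K) \<inter> (SOME F. fundamental_domain \<Gamma> \<tau> F)) = emeasure lborel (dirichlet - K)"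
proof -
  have "fundamental_domain \<Gamma> \<tau> (SOME F. fundamental_domain \<Gamma> \<tau> F)"
    using fundamental_domain_dirichlet by (rule someI)
  moreover have "closed \<Omega>" using \<Omega> unfolding tau_convex_def by blast
  then have "\<Omega> - K \<in> sets lebesgue" using K by simp
  moreover have "aff \<tau> g ` (\<Omega> - K) = \<Omega> - K" if "g \<in> \<Gamma>" for g
    using \<Omega>_aff K(2) that by (rule aff_image_Diff)
  ultimately have "emeasure lebesgue ((\<Omega> - K) \<inter> (SOME F. fundamental_domain \<Gamma> \<tau> F))
      = emeasure lebesgue ((\<Omega> - K) \<inter> dirichlet)"
    using fundamental_domain_dirichlet fundamental_domain_le by (metis order_antisym)
  also have "(\<Omega> - K) \<inter> dirichlet = dirichlet - K"
    using interior_subset by (auto simp: dirichlet_def)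
  also have "emeasure lebesgue (dirichlet - K) = emeasure lborel (dirichlet - K)"
    using K dirichlet_borel by simp
  finally show ?thesis .
qed

text \<open>The Dirichlet domain and the convex sets meet a line in direction \<open>v\<close> in half lines, so the
  convexity of volume differences holds on every line, and it integrates.\<close>
lemma volume_below_convex:
  assumes t: "0 \<le> t" "t \<le> 1"
    and K0: "tau_convex \<Gamma> \<tau> K0" and K1: "tau_convex \<Gamma> \<tau> K1" and D: "open D"
    and comb: "\<And>p q w. p \<in> K0 \<Longrightarrow> q \<in> K1 \<Longrightarrow> w \<in> chron_future \<Longrightarrow> (1 - t) *\<^sub>R p + t *\<^sub>R q + w \<in> D"
  shows "emeasure lborel (dirichlet - D)
    \<le> ennreal (1 - t) * emeasure lborel (dirichlet - K0) + ennreal t * emeasure lborel (dirichlet - K1)"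
proof -
  define e where "e = (1 / (v \<bullet> v)) *\<^sub>R v"
  have "v \<noteq> 0" using chron_future_time_pos[OF v] by auto
  then have ve: "v \<bullet> e = 1" by (simp add: e_def)
  define Q where "Q = {X. 0 \<le> X \<bullet> e \<and> X \<bullet> e < 1}"
  have Q: "Q \<in> sets borel" unfolding Q_def by measurable
  define len where "len S X = emeasure lborel {s. X + s *\<^sub>R v \<in> S}" for S X
  have vol: "emeasure lborel S = (\<integral>\<^sup>+X\<in>Q. len S X \<partial>lborel)" if "S \<in> sets borel" for S
    unfolding len_def Q_def by (rule emeasure_lborel_slices[OF that ve])
  have "closed K0" "closed K1" using K0 K1 unfolding tau_convex_def by blast+
  then have b: "K0 \<in> sets borel" "K1 \<in> sets borel" "D \<in> sets borel" using D by auto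
  note [measurable] = b dirichlet_borel Q
  have m: "len S \<in> borel_measurable borel" if "S \<in> sets borel" for S
    unfolding len_def by (rule measurable_slice_length[OF that])
  have slice_m: "{s. X + s *\<^sub>R v \<in> S} \<in> sets borel" if [measurable]: "S \<in> sets borel" for S X
  proof -
    have "{s \<in> space borel. X + s *\<^sub>R v \<in> S} \<in> sets borel" by measurable
    then show ?thesis by simp
  qed
  have bdd: "bdd_below {s. X + s *\<^sub>R v \<in> S}" if S: "S \<subseteq> \<Omega>" for S X
  proof -
    obtain h where h: "\<And>p. p \<in> \<Omega> \<Longrightarrow> mink p v \<le> h"
      using tau_convex_bounded_above[OF \<Omega> v] by blast
    have "(mink X v - h) / (- mink v v) \<le> s" if "X + s *\<^sub>R v \<in> S" for s
    proof -
      have "mink (X + s *\<^sub>R v) v \<le> h" using h S that by blast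
      then show ?thesis using chron_future_mink_neg[OF v] by (simp add: mink_bilinear field_simps)
    qed
    then show ?thesis by (auto simp: bdd_below_def)
  qed
  have sub: "K0 \<subseteq> \<Omega>" "K1 \<subseteq> \<Omega>"
    unfolding max using max_tau_convex_greatest(2)[OF K0] K0 K1 by blast+
  have sub': "dirichlet \<subseteq> \<Omega>" using interior_subset unfolding dirichlet_def by blast
  have le: "len (dirichlet - D) X
      \<le> ennreal (1 - t) * len (dirichlet - K0) X + ennreal t * len (dirichlet - K1) X" for X
  proof -
    have diff: "{s. X + s *\<^sub>R v \<in> S - T} = {s. X + s *\<^sub>R v \<in> S} - {s. X + s *\<^sub>R v \<in> T}" for S T
      by blast
    show ?thesis unfolding len_def diff
    proof (rule half_line_difference_convex[OF t])
      fix s r assume "s \<in> {s. X + s *\<^sub>R v \<in> dirichlet}" "s \<le> r"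
      then have "X + s *\<^sub>R v + (r - s) *\<^sub>R v \<in> dirichlet"
        using dirichlet_future[of "X + s *\<^sub>R v" "r - s"] by simp
      then show "r \<in> {s. X + s *\<^sub>R v \<in> dirichlet}" by (simp add: algebra_simps)
    next
      fix a0 a1 s
      assume a: "a0 \<in> {s. X + s *\<^sub>R v \<in> K0}" "a1 \<in> {s. X + s *\<^sub>R v \<in> K1}" "(1 - t) * a0 + t * a1 < s"
      define d where "d = s - ((1 - t) * a0 + t * a1)"
      have "d *\<^sub>R v \<in> chron_future" using a v by (intro chron_future_scale) (auto simp: d_def)
      then have "(1 - t) *\<^sub>R (X + a0 *\<^sub>R v) + t *\<^sub>R (X + a1 *\<^sub>R v) + d *\<^sub>R v \<in> D"
        using a by (intro comb) auto
      moreover have "(1 - t) *\<^sub>R (X + a0 *\<^sub>R v) + t *\<^sub>R (X + a1 *\<^sub>R v) + d *\<^sub>R v = X + s *\<^sub>R v"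
        by (simp add: d_def algebra_simps)
      ultimately show "s \<in> {s. X + s *\<^sub>R v \<in> D}" by simp
    qed (use bdd sub sub' slice_m b dirichlet_borel timelike_line_meets_future[OF v K0]
        timelike_line_meets_future[OF v K1] in auto)
  qed
  have "emeasure lborel (dirichlet - D) = (\<integral>\<^sup>+X\<in>Q. len (dirichlet - D) X \<partial>lborel)"
    by (intro vol) measurable
  also have "\<dots> \<le> (\<integral>\<^sup>+X. ennreal (1 - t) * (len (dirichlet - K0) X * indicator Q X)
      + ennreal t * (len (dirichlet - K1) X * indicator Q X) \<partial>lborel)"
    using mult_right_mono[OF le] by (intro nn_integral_mono) (simp add: distrib_right mult.assoc)
  also have "\<dots> = ennreal (1 - t) * (\<integral>\<^sup>+X\<in>Q. len (dirichlet - K0) X \<partial>lborel)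
      + ennreal t * (\<integral>\<^sup>+X\<in>Q. len (dirichlet - K1) X \<partial>lborel)"
  proof -
    have [measurable]: "len (dirichlet - K0) \<in> borel_measurable borel"
      "len (dirichlet - K1) \<in> borel_measurable borel"
      by (intro m; measurable)+
    show ?thesis by (subst nn_integral_add; (subst nn_integral_cmult)?; measurable?) (simp_all add: nn_integral_cmult)
  qed
  also have "\<dots> = ennreal (1 - t) * emeasure lborel (dirichlet - K0)
      + ennreal t * emeasure lborel (dirichlet - K1)"
    by (subst (1 2) vol) auto
  finally show ?thesis .
qed

end

section \<open>Convexity of the covolume\<close>

theorem theorem1p2:
  fixes \<Gamma> :: "'d::finite mink_mat set" and \<tau> :: "'d mink_mat \<Rightarrow> 'd mink"
    and K0 K1 :: "'d mink set" and t :: real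
  assumes "CARD('d) \<ge> 2"
    and "uniform_lattice \<Gamma>"
    and "cocycle \<Gamma> \<tau>"
    and "tau_convex \<Gamma> \<tau> K0"
    and "tau_convex \<Gamma> \<tau> K1"
    and "0 \<le> t" and "t \<le> 1"
  shows "covol \<Gamma> \<tau> ((\<lambda>x. (1 - t) *\<^sub>R x) ` K0 + (\<lambda>x. t *\<^sub>R x) ` K1)
           \<le> ennreal (1 - t) * covol \<Gamma> \<tau> K0 + ennreal t * covol \<Gamma> \<tau> K1"
proof -
  interpret affine_lattice \<Gamma> \<tau> by unfold_locales (use assms in auto)
  obtain v where v: "v \<in> chron_future" "\<And>g. g \<in> \<Gamma> \<Longrightarrow> g *v v = v \<Longrightarrow> g = mat 1"
    using exists_free_timelike by blast
  define \<Omega> where "\<Omega> = max_tau_convex \<Gamma> \<tau>"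
  interpret timelike_direction \<Gamma> \<tau> \<Omega> v
    by unfold_locales (use v max_tau_convex_greatest(1)[OF assms(4)] in \<open>auto simp: \<Omega>_def\<close>)
  define L where "L = (\<lambda>x. (1 - t) *\<^sub>R x) ` K0 + (\<lambda>x. t *\<^sub>R x) ` K1"
  have mem_L: "(1 - t) *\<^sub>R p + t *\<^sub>R q \<in> L" if "p \<in> K0" "q \<in> K1" for p q
    unfolding L_def using that by (intro set_plus_intro) auto
  have L_cases: "\<exists>p\<in>K0. \<exists>q\<in>K1. x = (1 - t) *\<^sub>R p + t *\<^sub>R q" if "x \<in> L" for x
    using that unfolding L_def by (auto elim!: set_plus_elim)
  have L_aff: "aff \<tau> g ` L = L" if "g \<in> \<Gamma>" for g
  proof (rule aff_image_eqI)
    fix h X assume h: "h \<in> \<Gamma>" and X: "X \<in> L"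
    obtain p q where pq: "p \<in> K0" "q \<in> K1" "X = (1 - t) *\<^sub>R p + t *\<^sub>R q" using L_cases[OF X] by blast
    have "aff \<tau> h X = (1 - t) *\<^sub>R aff \<tau> h p + t *\<^sub>R aff \<tau> h q"
      unfolding pq(3) by (rule aff_convex_comb) simp
    then show "aff \<tau> h X \<in> L" using mem_L tau_convex_aff h pq assms by metis
  qed (rule that)
  have future: "(1 - t) *\<^sub>R p + t *\<^sub>R q + w \<in> interior L"
    if pq: "p \<in> K0" "q \<in> K1" and w: "w \<in> chron_future" for p q w
  proof -
    define z where "z = (1 - t) *\<^sub>R p + t *\<^sub>R q"
    have "(+) z ` chron_future \<subseteq> L"
    proof
      fix x assume "x \<in> (+) z ` chron_future"
      then obtain u where u: "u \<in> chron_future" "x = z + u" by blast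
      have "x = (1 - t) *\<^sub>R (p + u) + t *\<^sub>R (q + u)" by (simp add: u z_def algebra_simps)
      then show "x \<in> L" using mem_L future_closed[OF assms(4) pq(1) u(1)]
          future_closed[OF assms(5) pq(2) u(1)] by blast
    qed
    then have "(+) z ` chron_future \<subseteq> interior L"
      by (intro interior_maximal open_translation open_chron_future)
    then show ?thesis using w unfolding z_def by blast
  qed
  have covol_eq: "covol \<Gamma> \<tau> K = emeasure lborel (dirichlet - K)" if K: "tau_convex \<Gamma> \<tau> K" for K
  proof -
    have "closed K" "\<And>g. g \<in> \<Gamma> \<Longrightarrow> aff \<tau> g ` K = K" using K unfolding tau_convex_def by blast+
    then show ?thesis unfolding covol_def \<Omega>_def[symmetric] by (intro covol_dirichlet) auto
  qed
  \<comment> \<open>The interior of \<open>L\<close> is a Borel set, it can only have a larger covolume than \<open>L\<close>, and it still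
    contains the chronological future of every combination of points of \<open>K0\<close> and \<open>K1\<close>.\<close>
  have "fundamental_domain \<Gamma> \<tau> (SOME F. fundamental_domain \<Gamma> \<tau> F)"
    using fundamental_domain_dirichlet by (rule someI)
  then have "(\<Omega> - interior L) \<inter> (SOME F. fundamental_domain \<Gamma> \<tau> F) \<in> sets lebesgue"
    using \<Omega> by (auto simp: fundamental_domain_def tau_convex_def)
  then have "covol \<Gamma> \<tau> L
      \<le> emeasure lebesgue ((\<Omega> - interior L) \<inter> (SOME F. fundamental_domain \<Gamma> \<tau> F))"
    unfolding covol_def \<Omega>_def[symmetric] using interior_subset[of L] by (intro emeasure_mono) auto
  also have "\<dots> = emeasure lborel (dirichlet - interior L)"
    by (intro covol_dirichlet aff_image_interior L_aff) auto
  also have "\<dots> \<le> ennreal (1 - t) * emeasure lborel (dirichlet - K0)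
      + ennreal t * emeasure lborel (dirichlet - K1)"
    using assms future by (intro volume_below_convex) auto
  finally show ?thesis by (simp add: covol_eq assms L_def)
qed

end
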